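(* Let $\sigma_1,\dots,\sigma_m$ be primitive, proper, positive endomorphisms of the free group $F_n$ on the positive generators $a_1,\dots,a_n$, and let $A_i\in M_n(\mathbb Z_{\ge0})$ be the matrix of the endomorphism of $H_1=\mathbb Z^n$ induced by $\sigma_i$ (with respect to the basis given by the generators). Suppose $A_1,\dots,A_m$ freely generate the semigroup they generate, i.e. distinct finite nonempty words in $A_1,\dots,A_m$ have distinct matrix products. Let $S$ be the collection of flow spaces admitting an expansion in which every $X_i$ is $W_n$ and every bonding map is one of $f_{\sigma_1},\dots,f_{\sigma_m}$ (admissible expansions, identified with their symbol sequences in $\{\sigma_1,\dots,\sigma_m\}$). Then two flow spaces in $S$ are flow equivalent if and only if they have admissible expansions whose symbol sequences are tail equivalent.
   Context: $W_n$: oriented wedge of $n$ circles labelled $a_1,\dots,a_n$. A positive endomorphism of $F_n$ maps the semigroup generated by $a_1,\dots,a_n$ into itself; for such $\sigma$, $f_\sigma\colon W_n\to W_n$ denotes a positive map (continuous surjection, wedge point to wedge point, orientation preserving on each circle, locally injective away from the wedge point) whose image of circle $a_j$ traverses in order the circles spelled by the positive word $\sigma(a_j)$. $\sigma$ is proper if there are letters $c,d$ with every $\sigma(a_j)=c\,v_j\,d$ for positive (possibly empty) words $v_j$; primitive if every $\sigma(a_j)$ contains every letter $a_1,\dots,a_n$. Flow space: compact metrizable space of dimension one with continuous $\mathbb R$-action without fixed points; flow equivalence: homeomorphism mapping orbits to orbits preserving flow orientation. Expansion of $\mathbb X$ about a point: oriented wedges $X_i$, positive maps $f_i\colon X_{i+1}\to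 X_i$, projections $p_i\colon\mathbb X\to X_i$ (continuous surjections, locally injective and orientation preserving along orbits, sending the point to the wedge point) with $p_n=f_n\circ\cdots\circ f_{m-1}\circ p_m$ and $x\mapsto(p_i(x))_i$ a homeomorphism onto $\varprojlim(X_i,f_i)$. Sequences $(s_i)$, $(t_i)$ are tail equivalent if there exist $k,l$ with $s_{k+j}=t_{l+j}$ for all $j\ge0$. *)

theory Defs
  imports "HOL-Analysis.Analysis"
begin

text \<open>Letters a_1..a_n are encoded as 0..n-1; an endomorphism sigma is given by
  the words sigma j (j < n), i.e. the images of the generators.\<close>

definition positive_endo :: "nat \<Rightarrow> (nat \<Rightarrow> nat list) \<Rightarrow> bool" where
  "positive_endo n \<sigma> \<longleftrightarrow> (\<forall>j<n. \<sigma> j \<noteq> [] \<and> set (\<sigma> j) \<subseteq> {..<n})"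

definition proper_endo :: "nat \<Rightarrow> (nat \<Rightarrow> nat list) \<Rightarrow> bool" where
  "proper_endo n \<sigma> \<longleftrightarrow> (\<exists>c<n. \<exists>d<n. \<forall>j<n. \<exists>v. set v \<subseteq> {..<n} \<and> \<sigma> j = c # v @ [d])"

definition primitive_endo :: "nat \<Rightarrow> (nat \<Rightarrow> nat list) \<Rightarrow> bool" where
  "primitive_endo n \<sigma> \<longleftrightarrow> (\<forall>j<n. \<forall>k<n. k \<in> set (\<sigma> j))"

definition abel_mat :: "nat \<Rightarrow> (nat \<Rightarrow> nat list) \<Rightarrow> nat \<Rightarrow> nat \<Rightarrow> nat" where
  "abel_mat n \<sigma> k j = (if k < n \<and> j < n then count_list (\<sigma> j) k else 0)"

definition mat_mult :: "nat \<Rightarrow> (nat \<Rightarrow> nat \<Rightarrow> nat) \<Rightarrow> (nat \<Rightarrow> nat \<Rightarrow> nat) \<Rightarrow> nat \<Rightarrow> nat \<Rightarrow> nat" where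
  "mat_mult n A B k j = (if k < n \<and> j < n then (\<Sum>l<n. A k l * B l j) else 0)"

definition mat_id :: "nat \<Rightarrow> nat \<Rightarrow> nat \<Rightarrow> nat" where
  "mat_id n k j = (if k < n \<and> j < n \<and> k = j then 1 else 0)"

fun word_prod :: "nat \<Rightarrow> (nat \<Rightarrow> nat \<Rightarrow> nat \<Rightarrow> nat) \<Rightarrow> nat list \<Rightarrow> nat \<Rightarrow> nat \<Rightarrow> nat" where
  "word_prod n A [] = mat_id n"
| "word_prod n A (i # w) = mat_mult n (A i) (word_prod n A w)"

definition freely_generate :: "nat \<Rightarrow> nat \<Rightarrow> (nat \<Rightarrow> nat \<Rightarrow> nat \<Rightarrow> nat) \<Rightarrow> bool" where
  "freely_generate n m A \<longleftrightarrow>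
     (\<forall>w w'. w \<noteq> [] \<and> w' \<noteq> [] \<and> set w \<subseteq> {..<m} \<and> set w' \<subseteq> {..<m} \<and> w \<noteq> w'
        \<longrightarrow> word_prod n A w \<noteq> word_prod n A w')"

text \<open>Circle j (j < n) is the circle in C with centre j+1 and radius j+1; these circles
  are pairwise tangent at 0 only, which is the wedge point. The circle j is
  parametrized (counterclockwise = positive orientation) by circ j on [0,1].\<close>

definition circ :: "nat \<Rightarrow> real \<Rightarrow> complex" where
  "circ j \<theta> = of_nat (j+1) * (1 - cis (2 * pi * \<theta>))"

definition wedge :: "nat \<Rightarrow> complex set" where
  "wedge n = (\<Union>j<n. circ j ` {0..1})"

text \<open>A path on [a,b] in W_n which moves positively (orientation preserving and locally
  injective): it is a concatenation of finitely many pieces, each running strictly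
  monotonically forward along a single circle.\<close>
definition positive_path :: "nat \<Rightarrow> (real \<Rightarrow> complex) \<Rightarrow> real \<Rightarrow> real \<Rightarrow> bool" where
  "positive_path n \<gamma> a b \<longleftrightarrow> a < b \<and>
     (\<exists>(k::nat) (u::nat \<Rightarrow> real) (c::nat \<Rightarrow> nat) (h::nat \<Rightarrow> real \<Rightarrow> real).
        k \<ge> 1 \<and> u 0 = a \<and> u k = b \<and>
        (\<forall>l<k. u l < u (Suc l) \<and> c l < n \<and>
           continuous_on {u l..u (Suc l)} (h l) \<and>
           strict_mono_on {u l..u (Suc l)} (h l) \<and>
           h l ` {u l..u (Suc l)} \<subseteq> {0..1} \<and>
           (\<forall>s\<in>{u l..u (Suc l)}. \<gamma> s = circ (c l) (h l s))))"

definition positive_map_of :: "nat \<Rightarrow> (nat \<Rightarrow> nat list) \<Rightarrow> (complex \<Rightarrow> complex) \<Rightarrow> bool" where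
  "positive_map_of n \<sigma> f \<longleftrightarrow>
     continuous_on (wedge n) f \<and> f ` wedge n = wedge n \<and> f 0 = 0 \<and>
     (\<forall>j<n. \<exists>(u::nat \<Rightarrow> real) (h::nat \<Rightarrow> real \<Rightarrow> real).
        u 0 = 0 \<and> u (length (\<sigma> j)) = 1 \<and>
        (\<forall>l<length (\<sigma> j). u l < u (Suc l) \<and>
           continuous_on {u l..u (Suc l)} (h l) \<and>
           strict_mono_on {u l..u (Suc l)} (h l) \<and>
           h l (u l) = 0 \<and> h l (u (Suc l)) = 1 \<and>
           (\<forall>\<theta>\<in>{u l..u (Suc l)}. f (circ j \<theta>) = circ (\<sigma> j ! l) (h l \<theta>))))"

definition cover_dim_le :: "'a::topological_space set \<Rightarrow> nat \<Rightarrow> bool" where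
  "cover_dim_le X k \<longleftrightarrow>
     (\<forall>\<U>. finite \<U> \<and> (\<forall>U\<in>\<U>. openin (top_of_set X) U) \<and> \<Union>\<U> = X \<longrightarrow>
        (\<exists>\<V>. finite \<V> \<and> (\<forall>V\<in>\<V>. openin (top_of_set X) V) \<and> \<Union>\<V> = X \<and>
              (\<forall>V\<in>\<V>. \<exists>U\<in>\<U>. V \<subseteq> U) \<and>
              (\<forall>x\<in>X. card {V\<in>\<V>. x \<in> V} \<le> k + 1)))"

definition dim_one :: "'a::topological_space set \<Rightarrow> bool" where
  "dim_one X \<longleftrightarrow> cover_dim_le X 1 \<and> \<not> cover_dim_le X 0"

definition is_flow :: "(real \<Rightarrow> 'a::topological_space \<Rightarrow> 'a) \<Rightarrow> bool" where
  "is_flow \<phi> \<longleftrightarrow> continuous_on UNIV (\<lambda>(t, x). \<phi> t x) \<and> (\<forall>x. \<phi> 0 x = x) \<and>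
     (\<forall>s t x. \<phi> (s + t) x = \<phi> s (\<phi> t x))"

definition flow_space :: "(real \<Rightarrow> 'a::metric_space \<Rightarrow> 'a) \<Rightarrow> bool" where
  "flow_space \<phi> \<longleftrightarrow> compact (UNIV :: 'a set) \<and> dim_one (UNIV :: 'a set) \<and>
     is_flow \<phi> \<and> (\<forall>x. \<exists>t. \<phi> t x \<noteq> x)"

definition orbit :: "(real \<Rightarrow> 'a \<Rightarrow> 'a) \<Rightarrow> 'a \<Rightarrow> 'a set" where
  "orbit \<phi> x = range (\<lambda>t. \<phi> t x)"

definition flow_equivalent :: "(real \<Rightarrow> 'a::topological_space \<Rightarrow> 'a) \<Rightarrow> (real \<Rightarrow> 'b::topological_space \<Rightarrow> 'b) \<Rightarrow> bool" where
  "flow_equivalent \<phi> \<psi> \<longleftrightarrow>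
     (\<exists>h g. homeomorphism UNIV UNIV h g \<and>
        (\<forall>x. h ` orbit \<phi> x = orbit \<psi> (h x)) \<and>
        (\<forall>x. \<exists>\<tau>::real \<Rightarrow> real. continuous_on UNIV \<tau> \<and> strict_mono \<tau> \<and> \<tau> 0 = 0 \<and>
              (\<forall>t. h (\<phi> t x) = \<psi> (\<tau> t) (h x))))"

text \<open>An admissible expansion (about some point x0) of the flow space with flow phi,
  with symbol sequence s (s i < m indexes sigma_{s i}); the bonding map
  X_{i+1} -> X_i is f (s i).\<close>
definition admissible_expansion ::
  "nat \<Rightarrow> nat \<Rightarrow> (nat \<Rightarrow> complex \<Rightarrow> complex) \<Rightarrow> (real \<Rightarrow> 'a::topological_space \<Rightarrow> 'a) \<Rightarrow> (nat \<Rightarrow> nat) \<Rightarrow> bool" where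
  "admissible_expansion n m f \<phi> s \<longleftrightarrow>
     (\<forall>i. s i < m) \<and>
     (\<exists>(x0::'a) (p::nat \<Rightarrow> 'a \<Rightarrow> complex).
        (\<forall>i. continuous_on UNIV (p i) \<and> range (p i) = wedge n \<and> p i x0 = 0) \<and>
        (\<forall>i x t. \<exists>\<epsilon>>0. positive_path n (\<lambda>\<tau>. p i (\<phi> \<tau> x)) (t - \<epsilon>) (t + \<epsilon>)) \<and>
        (\<forall>i x. p i x = f (s i) (p (Suc i) x)) \<and>
        (\<exists>g. homeomorphism UNIV {z. \<forall>i. z i \<in> wedge n \<and> z i = f (s i) (z (Suc i))}
                (\<lambda>x i. p i x) g))"

definition tail_equivalent :: "(nat \<Rightarrow> 'c) \<Rightarrow> (nat \<Rightarrow> 'c) \<Rightarrow> bool" where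
  "tail_equivalent s t \<longleftrightarrow> (\<exists>k l. \<forall>j. s (k + j) = t (l + j))"

end

theory Submission
  imports Defs
begin

text \<open>
  One direction only transports an expansion along the flow equivalence.  For the other, dropping
  initial segments of the symbol sequences leaves expansions of the two spaces over one and the same
  inverse sequence, hence a homeomorphism $h$ with $q_i \circ h = p_i$ for all $i$.  It remains to see
  that $h$ maps orbits to orbits.  Along an orbit, $p_i$ is a path in $W_n$ with a strictly increasing
  angular coordinate.  Compare the orbits of $x$ and $h(x)$ until the level 0 paths next meet the
  wedge point.  As the bonding maps fix the wedge point, no path of a higher level meets it meanwhile,
  so each level runs along a single circle.  At each level this is the same circle for the two orbits:
  a path that starts away from the wedge point has no choice.  At the wedge point, the circle is
  determined by the path of the next level if that one starts elsewhere, and otherwise it is the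
  circle of the common first letter of the words $\sigma(a_j)$.  So the reparametrization that
  matches level 0 matches all levels up to the next visit to the wedge point, and inductively for
  all positive times.  Negative times follow by starting earlier on the orbit.
\<close>

section \<open>Circles of the wedge and their angular coordinate\<close>

lemma circ_add_int: "circ j (\<theta> + of_int k) = circ j \<theta>"
proof -
  have "cis (2 * pi * (\<theta> + of_int k)) = cis (2 * pi * \<theta>) * cis (2 * pi * of_int k)"
    by (simp add: cis_mult algebra_simps)
  also have "cis (2 * pi * of_int k) = 1" by (rule cis_multiple_2pi) simp
  finally show ?thesis by (simp add: circ_def)
qed

lemma circ_diff_int: "circ j (x - of_int k) = circ j x"
  using circ_add_int[of j x "- k"] by simp

lemma cis_2pi_eq_iff: "cis (2 * pi * \<alpha>) = cis (2 * pi * \<beta>) \<longleftrightarrow> \<alpha> - \<beta> \<in> \<int>"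
proof -
  have "cis (2 * pi * \<alpha>) = cis (2 * pi * \<beta>) \<longleftrightarrow>
      exp (\<i> * of_real (2 * pi * \<alpha>)) = exp (\<i> * of_real (2 * pi * \<beta>))"
    by (simp add: cis_conv_exp)
  also have "\<dots> \<longleftrightarrow> (\<exists>n::int. 2 * pi * \<alpha> = 2 * pi * \<beta> + of_int (2 * n) * pi)"
    unfolding exp_eq by (simp add: complex_eq_iff)
  also have "\<dots> \<longleftrightarrow> (\<exists>n::int. \<alpha> - \<beta> = of_int n)"
  proof (rule iff_exI)
    fix n :: int
    have "2 * pi * \<alpha> = 2 * pi * \<beta> + of_int (2 * n) * pi \<longleftrightarrow> 2 * pi * (\<alpha> - \<beta>) = 2 * pi * of_int n"
      by (simp add: algebra_simps)
    then show "2 * pi * \<alpha> = 2 * pi * \<beta> + of_int (2 * n) * pi \<longleftrightarrow> \<alpha> - \<beta> = of_int n"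
      by simp
  qed
  also have "\<dots> \<longleftrightarrow> \<alpha> - \<beta> \<in> \<int>"
    by (auto elim: Ints_cases)
  finally show ?thesis .
qed

lemma circ_eq_0_iff: "circ j \<theta> = 0 \<longleftrightarrow> \<theta> \<in> \<int>"
proof -
  have "circ j \<theta> = 0 \<longleftrightarrow> cis (2 * pi * \<theta>) = cis (2 * pi * 0)"
    by (auto simp: circ_def add_eq_0_iff2 simp flip: of_nat_Suc)
  then show ?thesis using cis_2pi_eq_iff[of \<theta> 0] by simp
qed

lemma norm_circ_squared: "(cmod (circ j \<theta>))\<^sup>2 = 2 * (real j + 1) * Re (circ j \<theta>)"
proof -
  have "(1 - cos (2 * pi * \<theta>))\<^sup>2 + (sin (2 * pi * \<theta>))\<^sup>2 = 2 * (1 - cos (2 * pi * \<theta>))"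
    using sin_cos_squared_add[of "2 * pi * \<theta>"] by (simp add: power2_diff)
  moreover have "Re (circ j \<theta>) = (real j + 1) * (1 - cos (2 * pi * \<theta>))"
    "Im (circ j \<theta>) = - (real j + 1) * sin (2 * pi * \<theta>)"
    by (simp_all add: circ_def algebra_simps)
  ultimately show ?thesis
    unfolding cmod_power2 by algebra
qed

text \<open>A point $z \neq 0$ of the circle with centre and radius $r$ satisfies
  $|z|^2 = 2 r \,\mathrm{Re}\, z$, so that $1 - z / r$, its angular coordinate, can be written
  without $r$.  The value at 0 is 1.\<close>
definition wind :: "complex \<Rightarrow> complex" where
  "wind z = 1 - of_real (2 * Re z) / cnj z"

lemma wind_circ: "wind (circ j \<theta>) = cis (2 * pi * \<theta>)"
proof (cases "circ j \<theta> = 0")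
  case True
  then have "cis (2 * pi * \<theta>) = 1"
    by (auto simp: circ_def simp flip: of_nat_Suc)
  then show ?thesis using True by (simp add: wind_def)
next
  case False
  define z where "z = circ j \<theta>"
  have "z * cnj z = of_real ((cmod z)\<^sup>2)"
    by (simp only: complex_norm_square)
  also have "\<dots> = of_real (2 * Re z) * (of_nat j + 1)"
    by (simp add: z_def norm_circ_squared mult_ac)
  finally have "of_real (2 * Re z) / cnj z = z / (of_nat j + 1)"
    using False by (simp add: z_def field_simps add_eq_0_iff2 flip: of_nat_Suc)
  then show ?thesis
    using of_nat_neq_0[of j, where ?'a = complex]
    by (simp add: wind_def z_def[symmetric]) (simp add: z_def circ_def add.commute)
qed

lemma circ_eqD:
  assumes "circ i \<alpha> = circ j \<beta>"
  shows "\<alpha> - \<beta> \<in> \<int>"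
  using assms wind_circ cis_2pi_eq_iff by metis

text \<open>The circle of centre and radius r has the equation |z|^2 = 2 r Re z. For z other than 0
  this forces Re z to be nonzero, so z determines r.\<close>

lemma circ_eq_imp_index:
  assumes "circ i \<alpha> = circ j \<beta>" "circ i \<alpha> \<noteq> 0"
  shows "i = j"
proof -
  have "2 * (real i + 1) * Re (circ i \<alpha>) = (cmod (circ i \<alpha>))\<^sup>2"
    by (simp only: norm_circ_squared)
  also have "\<dots> = 2 * (real j + 1) * Re (circ i \<alpha>)"
    by (simp only: assms(1) norm_circ_squared)
  finally have "2 * (real i + 1) * Re (circ i \<alpha>) = 2 * (real j + 1) * Re (circ i \<alpha>)" .
  moreover have "Re (circ i \<alpha>) \<noteq> 0"
    using norm_circ_squared[of i \<alpha>] assms(2) by auto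
  ultimately have "real i + 1 = real j + 1" by (simp only: mult_cancel_right mult_cancel_left) simp
  then show ?thesis by simp
qed

lemma circ_in_wedge: "j < n \<Longrightarrow> circ j \<theta> \<in> wedge n"
proof -
  assume "j < n"
  have "circ j \<theta> = circ j (frac \<theta>)"
    using circ_add_int[of j "frac \<theta>" "\<lfloor>\<theta>\<rfloor>"] by (simp add: frac_def)
  moreover have "frac \<theta> \<in> {0..1}" using frac_lt_1[of \<theta>] by (simp add: less_imp_le)
  ultimately show ?thesis using \<open>j < n\<close> unfolding wedge_def by blast
qed

lemma wedge_iff: "z \<in> wedge n \<longleftrightarrow> (\<exists>j<n. \<exists>\<theta>. z = circ j \<theta>)"
  using circ_in_wedge by (auto simp: wedge_def)

text \<open>Only 0 needs an argument. On the circle of radius \<open>j + 1\<close> the value is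
  \<open>1 - z / (j + 1)\<close>, which differs from 1 by at most |z| because every radius is at
  least 1.\<close>

lemma continuous_on_wind: "continuous_on (wedge n) wind"
  unfolding continuous_on_eq_continuous_within
proof
  fix z assume z: "z \<in> wedge n"
  show "continuous (at z within wedge n) wind"
  proof (cases "z = 0")
    case False
    then show ?thesis
      unfolding wind_def by (intro continuous_intros) auto
  next
    case True
    have bound: "cmod (wind x - 1) \<le> cmod x" if "x \<in> wedge n" for x
    proof -
      obtain j \<theta> where x: "x = circ j \<theta>" using \<open>x \<in> wedge n\<close> by (auto simp: wedge_iff)
      have "cmod (wind x - 1) * (real j + 1) = cmod ((wind x - 1) * of_nat (Suc j))"
        by (simp only: norm_mult norm_of_nat) (simp only: of_nat_Suc add.commute)
      also have "(wind x - 1) * of_nat (Suc j) = - x"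
        by (simp add: x wind_circ) (simp add: circ_def algebra_simps)
      finally have eq: "cmod (wind x - 1) * (real j + 1) = cmod x" by simp
      have "cmod (wind x - 1) * 1 \<le> cmod (wind x - 1) * (real j + 1)"
        by (rule mult_left_mono) auto
      with eq show ?thesis by simp
    qed
    have "((\<lambda>x. wind x - 1) \<longlongrightarrow> 0) (at 0 within wedge n)"
    proof (rule Lim_null_comparison)
      show "\<forall>\<^sub>F x in at 0 within wedge n. cmod (wind x - 1) \<le> cmod x"
        using bound by (simp add: eventually_at_filter)
      show "(cmod \<longlongrightarrow> 0) (at 0 within wedge n)"
        by (rule tendsto_norm_zero) (rule tendsto_ident_at)
    qed
    then have "(wind \<longlongrightarrow> 1) (at 0 within wedge n)" by (simp add: LIM_zero_iff)
    then show ?thesis using True by (simp add: continuous_within wind_def)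
  qed
qed

section \<open>Lifts of paths in the wedge to the real line\<close>

text \<open>Only the angular coordinate is lifted, while the circle \<open>j\<close> may vary with
  \<open>t\<close>. As the wedge point has integer coordinates on every circle, \<open>L\<close> can
  be continuous even where the path changes circles.\<close>

definition lift :: "nat \<Rightarrow> real set \<Rightarrow> (real \<Rightarrow> complex) \<Rightarrow> (real \<Rightarrow> real) \<Rightarrow> bool" where
  "lift n S \<gamma> L \<longleftrightarrow> continuous_on S L \<and> (\<forall>t\<in>S. \<exists>j<n. \<gamma> t = circ j (L t))"

text \<open>Along the path \<open>wind\<close> is continuous and never 0, so it has a continuous
  logarithm on the contractible set \<open>S\<close>. The imaginary part of the logarithm, divided
  by \<open>2 * pi\<close>, is the lift.\<close>

lemma lift_exists:
  assumes "convex S" "continuous_on S \<gamma>" "\<gamma> ` S \<subseteq> wedge n"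
  obtains L where "lift n S \<gamma> L"
proof -
  have "continuous_on S (\<lambda>t. wind (\<gamma> t))"
    using continuous_on_compose2[OF continuous_on_wind assms(2,3)] .
  moreover have "wind (\<gamma> t) \<noteq> 0" if "t \<in> S" for t
  proof -
    have "\<gamma> t \<in> wedge n" using assms(3) \<open>t \<in> S\<close> by blast
    then obtain j \<theta> where "\<gamma> t = circ j \<theta>" by (auto simp: wedge_iff)
    then show ?thesis by (simp add: wind_circ)
  qed
  ultimately obtain g where g: "continuous_on S g" "\<And>t. t \<in> S \<Longrightarrow> wind (\<gamma> t) = exp (g t)"
    using continuous_logarithm_on_contractible[OF _ convex_imp_contractible[OF \<open>convex S\<close>]] by metis
  define L where "L t = Im (g t) / (2 * pi)" for t
  have "\<exists>j<n. \<gamma> t = circ j (L t)" if "t \<in> S" for t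
  proof -
    have "\<gamma> t \<in> wedge n" using assms(3) \<open>t \<in> S\<close> by blast
    then obtain j \<theta> where j: "j < n" "\<gamma> t = circ j \<theta>" by (auto simp: wedge_iff)
    have eq: "cis (2 * pi * \<theta>) = exp (g t)"
      using g(2)[OF \<open>t \<in> S\<close>] j by (simp add: wind_circ)
    \<comment> \<open>\<open>wind\<close> has modulus 1 on the wedge, so the real part of the
      logarithm contributes nothing.\<close>
    then have "exp (Re (g t)) = 1" by (metis norm_cis norm_exp_eq_Re)
    then have "exp (g t) = cis (2 * pi * L t)"
      by (simp add: L_def exp_eq_polar)
    then have "circ j (L t) = circ j \<theta>" using eq by (simp add: circ_def)
    with j show ?thesis by auto
  qed
  moreover have "continuous_on S L"
    unfolding L_def by (intro continuous_intros g) auto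
  ultimately have "lift n S \<gamma> L" by (simp add: lift_def)
  then show thesis by (rule that)
qed

lemma Ints_valued_constant:
  fixes g :: "'a::topological_space \<Rightarrow> real"
  assumes "connected S" "continuous_on S g" "\<And>x. x \<in> S \<Longrightarrow> g x \<in> \<int>" "x \<in> S" "y \<in> S"
  shows "g x = g y"
proof -
  have "g constant_on S"
  proof (rule continuous_discrete_range_constant[OF assms(1,2)])
    fix x assume "x \<in> S"
    have "1 \<le> norm (g y - g x)" if "y \<in> S" "g y \<noteq> g x" for y
      using Ints_nonzero_abs_ge1[of "g y - g x"] assms(3) that \<open>x \<in> S\<close> by auto
    then show "\<exists>e>0. \<forall>y. y \<in> S \<and> g y \<noteq> g x \<longrightarrow> e \<le> norm (g y - g x)"
      by (intro exI[of _ 1]) auto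
  qed
  then show ?thesis using assms(4,5) by (auto simp: constant_on_def)
qed

text \<open>Both lifts are angles of the same point at each time, so their difference is continuous
  and integer-valued.\<close>

lemma lift_unique:
  assumes "connected S" "lift n S \<gamma> L" "lift n' S \<gamma> M" "x \<in> S" "y \<in> S"
  shows "L x - M x = L y - M y"
proof (rule Ints_valued_constant[of S "\<lambda>t. L t - M t"])
  show "continuous_on S (\<lambda>t. L t - M t)"
    using assms(2,3) by (auto simp: lift_def intro: continuous_intros)
  show "L t - M t \<in> \<int>" if "t \<in> S" for t
    using assms(2,3) that circ_eqD unfolding lift_def by metis
qed (use assms in auto)

lemma lift_subset: "lift n S \<gamma> L \<Longrightarrow> T \<subseteq> S \<Longrightarrow> lift n T \<gamma> L"
  by (auto simp: lift_def intro: continuous_on_subset)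

lemma lift_shift: "lift n S \<gamma> L \<Longrightarrow> c \<in> \<int> \<Longrightarrow> lift n S \<gamma> (\<lambda>t. L t + c)"
  by (auto simp: lift_def circ_add_int intro!: continuous_intros elim!: Ints_cases)

lemma lift_translate:
  assumes "lift n UNIV \<gamma> L"
  shows "lift n UNIV (\<lambda>t. \<gamma> (t + r)) (\<lambda>t. L (t + r))"
proof -
  have "continuous_on UNIV (\<lambda>t. L (t + r))"
    by (rule continuous_on_compose2[of UNIV L]) (use assms in \<open>auto simp: lift_def intro!: continuous_intros\<close>)
  then show ?thesis using assms by (simp add: lift_def)
qed

lemma lift_cong: "(\<And>t. t \<in> S \<Longrightarrow> \<gamma> t = \<gamma>' t) \<Longrightarrow> lift n S \<gamma> L \<Longrightarrow> lift n S \<gamma>' L"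
  by (simp add: lift_def)

section \<open>Positive paths and their increasing lifts\<close>

lemma strict_mono_on_glue:
  fixes L :: "real \<Rightarrow> real"
  assumes "strict_mono_on {a..b} L" "strict_mono_on {b..c} L"
  shows "strict_mono_on {a..c} L"
proof (rule strict_mono_onI)
  fix r s assume rs: "r \<in> {a..c}" "s \<in> {a..c}" "r < s"
  consider "s \<le> b" | "b \<le> r" | "r < b" "b < s" by linarith
  then show "L r < L s"
  proof cases
    case 3
    then have "L r < L b" "L b < L s"
      using rs assms by (auto simp: strict_mono_on_def)
    then show ?thesis by simp
  qed (use rs assms in \<open>auto simp: strict_mono_on_def\<close>)
qed

text \<open>On each piece of the path \<open>h l\<close> is itself a lift, so \<open>L\<close>
  differs from it by a constant and inherits its monotonicity.\<close>

lemma positive_path_lift_strict_mono: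
  assumes "positive_path n \<gamma> a b" "lift n {a..b} \<gamma> L"
  shows "strict_mono_on {a..b} L"
proof -
  obtain k :: nat and u c h where k: "k \<ge> 1" "u 0 = a" "u k = b"
    and piece: "\<And>l. l < k \<Longrightarrow> u l < u (Suc l) \<and> c l < n \<and>
           continuous_on {u l..u (Suc l)} (h l) \<and>
           strict_mono_on {u l..u (Suc l)} (h l) \<and>
           h l ` {u l..u (Suc l)} \<subseteq> {0..1} \<and>
           (\<forall>s\<in>{u l..u (Suc l)}. \<gamma> s = circ (c l) (h l s))"
    using assms(1) unfolding positive_path_def by metis
  have mono: "u i \<le> u j" if "i \<le> j" "j \<le> k" for i j
    using that
  proof (induction j)
    case (Suc j)
    then show ?case using piece[of j] by (cases "i = Suc j") (auto simp: less_eq_Suc_le)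
  qed simp
  have "strict_mono_on {a..u l} L" if "l \<le> k" for l
    using that
  proof (induction l)
    case 0
    then show ?case by (auto simp: k strict_mono_on_def)
  next
    case (Suc l)
    then have P: "u l < u (Suc l)" "continuous_on {u l..u (Suc l)} (h l)" "c l < n"
      "strict_mono_on {u l..u (Suc l)} (h l)" "\<forall>s\<in>{u l..u (Suc l)}. \<gamma> s = circ (c l) (h l s)"
      using piece[of l] by auto
    have "{u l..u (Suc l)} \<subseteq> {a..b}"
      using mono[of 0 l] mono[of "Suc l" k] Suc.prems k by auto
    then have 1: "lift n {u l..u (Suc l)} \<gamma> L" using assms(2) lift_subset by blast
    have 2: "lift n {u l..u (Suc l)} \<gamma> (h l)"
      using P by (auto simp: lift_def)
    have "L r - h l r = L s - h l s" if "r \<in> {u l..u (Suc l)}" "s \<in> {u l..u (Suc l)}" for r s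
      using lift_unique[OF _ 1 2 that] by simp
    then have "strict_mono_on {u l..u (Suc l)} L"
      using P(4) unfolding strict_mono_on_def by (smt (verit, best))
    then show ?case using Suc strict_mono_on_glue by simp
  qed
  from this[of k] show ?thesis by (simp add: k)
qed

text \<open>Meant for the paths \<open>\<lambda>t. p i (\<phi> t x)\<close>, the projections of a
  whole orbit to one level of an expansion.\<close>

definition positive_line :: "nat \<Rightarrow> (real \<Rightarrow> complex) \<Rightarrow> bool" where
  "positive_line n \<gamma> \<longleftrightarrow> continuous_on UNIV \<gamma> \<and> range \<gamma> \<subseteq> wedge n \<and>
     (\<forall>t. \<exists>\<epsilon>>0. positive_path n \<gamma> (t - \<epsilon>) (t + \<epsilon>))"

lemma positive_line_lift_exists:
  assumes "positive_line n \<gamma>"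
  obtains L where "lift n UNIV \<gamma> L"
  using assms lift_exists[of UNIV \<gamma> n] by (auto simp: positive_line_def)

lemma positive_line_lift_strict_mono:
  assumes "positive_line n \<gamma>" "lift n UNIV \<gamma> L"
  shows "strict_mono L"
proof (rule strict_monoI)
  fix a b :: real assume "a < b"
  have "strict_mono_on {a..b} L"
  \<comment> \<open>Bisection spreads the local monotonicity to the whole interval, since it glues
    along adjacent intervals.\<close>
  proof (rule Bolzano[of a b "\<lambda>a b. strict_mono_on {a..b} L"])
    fix x
    obtain \<epsilon> where \<epsilon>: "\<epsilon> > 0" "positive_path n \<gamma> (x - \<epsilon>) (x + \<epsilon>)"
      using assms(1) by (auto simp: positive_line_def)
    then have "strict_mono_on {x - \<epsilon>..x + \<epsilon>} L"
      using positive_path_lift_strict_mono lift_subset[OF assms(2)] by blast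
    then have "strict_mono_on {a..b} L" if "a \<le> x" "x \<le> b" "b - a < \<epsilon>" for a b
      by (rule monotone_on_subset) (use that in auto)
    then show "\<exists>d>0. \<forall>a b. a \<le> x \<and> x \<le> b \<and> b - a < d \<longrightarrow> strict_mono_on {a..b} L"
      using \<epsilon>(1) by blast
  qed (use \<open>a < b\<close> strict_mono_on_glue in auto)
  then show "L a < L b"
    using \<open>a < b\<close> by (auto simp: strict_mono_on_def)
qed

lemma lift_less_iff:
  assumes "positive_line n \<gamma>" "lift n UNIV \<gamma> L"
  shows "L s < L t \<longleftrightarrow> s < t" "L s \<le> L t \<longleftrightarrow> s \<le> t" "L s = L t \<longleftrightarrow> s = t"
  using positive_line_lift_strict_mono[OF assms]
  by (simp_all add: strict_mono_less strict_mono_less_eq strict_mono_eq)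

lemma lift_IVT:
  assumes "lift n UNIV \<gamma> L" "s \<le> t" "L s \<le> y" "y \<le> L t"
  obtains r where "s \<le> r" "r \<le> t" "L r = y"
  using IVT'[of L s y t] assms continuous_on_subset[of UNIV L "{s..t}"] by (auto simp: lift_def)

text \<open>Between visits to the wedge point the lift avoids the integers, and the radius of the
  current circle depends continuously on the point, hence is constant. The ends can be included
  because the wedge point lies on every circle.\<close>

lemma lift_letter:
  assumes \<gamma>: "positive_line n \<gamma>" "lift n UNIV \<gamma> L" and "s < t"
    and nz: "\<And>r. s < r \<Longrightarrow> r < t \<Longrightarrow> \<gamma> r \<noteq> 0"
  obtains j where "j < n" "\<And>r. s \<le> r \<Longrightarrow> r \<le> t \<Longrightarrow> \<gamma> r = circ j (L r)"
    "\<And>r. s \<le> r \<Longrightarrow> r \<le> t \<Longrightarrow> L r - of_int \<lfloor>L s\<rfloor> \<in> {0..1}"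
proof -
  define K :: real where "K = of_int \<lfloor>L s\<rfloor>"
  have nonint: "L r \<notin> \<int>" if "s < r" "r < t" for r
    using \<gamma>(2) nz[OF that] circ_eq_0_iff unfolding lift_def by (metis UNIV_I)
  have less: "L r < L r' \<longleftrightarrow> r < r'" for r r' using lift_less_iff[OF \<gamma>] by auto
  have "L t \<le> K + 1"
  proof (rule ccontr)
    assume "\<not> L t \<le> K + 1"
    moreover have "L s < K + 1" unfolding K_def by linarith
    ultimately obtain r where r: "s \<le> r" "r \<le> t" "L r = K + 1"
      using lift_IVT[OF \<gamma>(2), of s t "K + 1"] \<open>s < t\<close> by (metis less_imp_le not_le)
    then have "s < r" "r < t" using \<open>L s < K + 1\<close> \<open>\<not> L t \<le> K + 1\<close> by (auto simp: order_less_le)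
    then have "K + 1 \<notin> \<int>" using nonint r(3) by metis
    then show False by (simp add: K_def)
  qed
  moreover have "K \<le> L s" by (simp add: K_def)
  ultimately have K: "K \<le> L r" "L r \<le> K + 1" if "s \<le> r" "r \<le> t" for r
    using that lift_less_iff(2)[OF \<gamma>] by (meson order_trans)+
  \<comment> \<open>All interior times belong to \<open>S\<close>, and an end belongs to it unless
    the path is at the wedge point there. So \<open>S\<close> is an interval.\<close>
  define S where "S = {r \<in> {s..t}. L r \<notin> \<int>}"
  have "connected S"
    unfolding is_interval_connected_1[symmetric] is_interval_1
  proof (intro ballI allI impI)
    fix a b x assume "a \<in> S" "b \<in> S" "a \<le> x \<and> x \<le> b"
    then show "x \<in> S"
      using nonint[of x] by (cases "x = a"; cases "x = b") (auto simp: S_def)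
  qed
  \<comment> \<open>The equation |z|^2 = 2 r Re z solved for the radius r.\<close>
  define g where "g z = (cmod z)\<^sup>2 / (2 * Re z)" for z
  have g: "g (circ j \<theta>) = real j + 1" if "\<theta> \<notin> \<int>" for j \<theta>
  proof -
    have "Re (circ j \<theta>) \<noteq> 0"
      using norm_circ_squared[of j \<theta>] that circ_eq_0_iff[of j \<theta>] by auto
    then show ?thesis by (simp add: g_def norm_circ_squared)
  qed
  have on_S: "\<exists>j<n. \<gamma> r = circ j (L r) \<and> g (\<gamma> r) = real j + 1" if "r \<in> S" for r
    using \<gamma>(2) g that unfolding lift_def S_def by (metis (mono_tags, lifting) UNIV_I mem_Collect_eq)
  have "continuous_on S (\<lambda>r. g (\<gamma> r))"
    unfolding g_def
  proof (intro continuous_intros)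
    show "continuous_on S \<gamma>" using \<gamma>(1) continuous_on_subset by (auto simp: positive_line_def)
    then show "continuous_on S \<gamma>" .
    show "\<forall>r\<in>S. 2 * Re (\<gamma> r) \<noteq> 0"
    proof
      fix r assume "r \<in> S"
      \<comment> \<open>If the denominator were 0, \<open>g\<close> would have the default value 0
        and not \<open>real j + 1\<close>.\<close>
      then show "2 * Re (\<gamma> r) \<noteq> 0" using on_S[of r] by (auto simp: g_def)
    qed
  qed
  then have const: "g (\<gamma> r) = g (\<gamma> r')" if "r \<in> S" "r' \<in> S" for r r'
    using on_S that by (intro Ints_valued_constant[OF \<open>connected S\<close>, of "\<lambda>r. g (\<gamma> r)"]) fastforce+
  have mid: "(s + t) / 2 \<in> S" using \<open>s < t\<close> nonint by (auto simp: S_def)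
  then obtain j where j: "j < n" "g (\<gamma> ((s + t) / 2)) = real j + 1" using on_S by blast
  have "\<gamma> r = circ j (L r)" if "s \<le> r" "r \<le> t" for r
  proof (cases "L r \<in> \<int>")
    case True
    then show ?thesis using \<gamma>(2) circ_eq_0_iff unfolding lift_def by (metis UNIV_I)
  next
    case False
    then have "r \<in> S" using that by (simp add: S_def)
    then show ?thesis using on_S[of r] const[OF mid, of r] j by auto
  qed
  with that[of j] j K show thesis by (fastforce simp: K_def)
qed

section \<open>Lifts along the orbits of a compact flow\<close>

text \<open>By compactness the points \<open>\<phi> (T k) x\<close> accumulate at some
  \<open>y\<close>. If the lift had the same limit \<open>l\<close> along all shifts of
  \<open>T\<close>, the projected orbit of \<open>y\<close> would have constant angular coordinate,
  but its lift is strictly increasing.\<close>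

lemma positive_line_unbounded:
  fixes \<phi> :: "real \<Rightarrow> 'a::metric_space \<Rightarrow> 'a"
  assumes "compact (UNIV :: 'a set)" "is_flow \<phi>" "continuous_on UNIV p"
    and pos: "\<And>x. positive_line n (\<lambda>t. p (\<phi> t x))"
    and L: "lift n UNIV (\<lambda>t. p (\<phi> t x)) L"
    and T: "\<And>s. (\<lambda>k. L (T k + s)) \<longlonglongrightarrow> l"
  shows False
proof -
  have "\<exists>y r. strict_mono (r :: nat \<Rightarrow> nat) \<and> ((\<lambda>k. \<phi> (T k) x) \<circ> r) \<longlonglongrightarrow> y"
    using assms(1) by (auto simp: compact_def)
  then obtain y and r :: "nat \<Rightarrow> nat" where r: "strict_mono r" "(\<lambda>k. \<phi> (T (r k)) x) \<longlonglongrightarrow> y"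
    by (auto simp: o_def)
  have flow: "continuous_on UNIV (\<phi> s)" for s
  proof -
    have "continuous_on UNIV ((\<lambda>(t, x). \<phi> t x) \<circ> Pair s)"
      using assms(2) by (intro continuous_on_compose continuous_intros)
        (auto simp: is_flow_def intro: continuous_on_subset)
    then show ?thesis by (simp add: o_def)
  qed
  have "wind (p (\<phi> s y)) = cis (2 * pi * l)" for s
  proof (rule LIMSEQ_unique)
    have "range (p \<circ> \<phi> s) \<subseteq> wedge n" using pos by (auto simp: positive_line_def)
    then have "continuous_on UNIV (\<lambda>z. wind (p (\<phi> s z)))"
      by (intro continuous_on_compose2[OF continuous_on_wind[of n]]
          continuous_on_compose2[OF assms(3) flow]) auto
    then show "(\<lambda>k. wind (p (\<phi> s (\<phi> (T (r k)) x)))) \<longlonglongrightarrow> wind (p (\<phi> s y))"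
      by (rule continuous_on_tendsto_compose[OF _ r(2)]) auto
    have "wind (p (\<phi> s (\<phi> t x))) = cis (2 * pi * L (t + s))" for t
    proof -
      have "\<phi> s (\<phi> t x) = \<phi> (t + s) x" using assms(2) by (metis add.commute is_flow_def)
      then show ?thesis using L wind_circ unfolding lift_def by (metis UNIV_I)
    qed
    moreover have "(\<lambda>k. cis (2 * pi * L (T (r k) + s))) \<longlonglongrightarrow> cis (2 * pi * l)"
      by (intro tendsto_intros continuous_on_tendsto_compose[OF continuous_on_cis]
          LIMSEQ_subseq_LIMSEQ[OF T r(1), unfolded o_def])
    ultimately show "(\<lambda>k. wind (p (\<phi> s (\<phi> (T (r k)) x)))) \<longlonglongrightarrow> cis (2 * pi * l)" by simp
  qed
  moreover obtain M where M: "lift n UNIV (\<lambda>t. p (\<phi> t y)) M"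
    using positive_line_lift_exists[OF pos] .
  ultimately have "cis (2 * pi * M s) = cis (2 * pi * l)" for s
    using wind_circ unfolding lift_def by (metis UNIV_I)
  then have int: "M s - l \<in> \<int>" for s by (simp add: cis_2pi_eq_iff)
  have "M 0 - l = M 1 - l"
    by (rule Ints_valued_constant[of UNIV "\<lambda>s. M s - l"])
      (use M int in \<open>auto simp: lift_def intro!: continuous_intros\<close>)
  then show False using lift_less_iff(3)[OF pos M, of 0 1] by simp
qed

text \<open>A lift that is bounded above converges to its supremum at infinity, and so it does along
  the times \<open>real k + s\<close> for every \<open>s\<close>, which
  \<open>positive_line_unbounded\<close> excludes. The lower side is symmetric, and the intermediate
  value theorem fills the gaps.\<close>

lemma surj_lift:
  fixes \<phi> :: "real \<Rightarrow> 'a::metric_space \<Rightarrow> 'a"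
  assumes "compact (UNIV :: 'a set)" "is_flow \<phi>" "continuous_on UNIV p"
    and pos: "\<And>x. positive_line n (\<lambda>t. p (\<phi> t x))"
    and L: "lift n UNIV (\<lambda>t. p (\<phi> t x)) L"
  shows "surj L"
proof -
  note no_limit = positive_line_unbounded[OF assms]
  have le: "L s \<le> L t \<longleftrightarrow> s \<le> t" for s t using lift_less_iff[OF pos L] by auto
  have above: "\<exists>b. y \<le> L b" for y
  proof (rule ccontr)
    assume "\<not> ?thesis"
    then have bdd: "bdd_above (range L)" by (auto simp: bdd_above_def not_le intro: less_imp_le)
    have "(L \<longlongrightarrow> Sup (range L)) at_top"
    proof (rule increasing_tendsto)
      show "\<forall>\<^sub>F t in at_top. L t \<le> Sup (range L)" using bdd by (simp add: cSup_upper)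
      fix z assume "z < Sup (range L)"
      then obtain t where "z < L t" using less_cSup_iff[OF _ bdd] by auto
      then show "\<forall>\<^sub>F t in at_top. z < L t"
        using le by (intro eventually_at_top_linorderI[of t]) (metis less_le_trans)
    qed
    moreover have "filterlim (\<lambda>k. real k + s) at_top sequentially" for s
      by real_asymp
    ultimately have "(\<lambda>k. L (real k + s)) \<longlonglongrightarrow> Sup (range L)" for s
      by (rule filterlim_compose)
    then show False by (rule no_limit)
  qed
  have below: "\<exists>a. L a \<le> y" for y
  proof (rule ccontr)
    assume "\<not> ?thesis"
    then have bdd: "bdd_below (range L)" by (auto simp: bdd_below_def not_le intro: less_imp_le)
    have "(L \<longlongrightarrow> Inf (range L)) at_bot"
    proof (rule decreasing_tendsto)
      show "\<forall>\<^sub>F t in at_bot. Inf (range L) \<le> L t" using bdd by (simp add: cInf_lower)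
      fix z assume "Inf (range L) < z"
      then obtain t where "L t < z" using cInf_less_iff[OF _ bdd] by auto
      then have "\<forall>s\<le>t. L s < z" using le by (metis le_less_trans)
      then show "\<forall>\<^sub>F t in at_bot. L t < z" by (auto simp: eventually_at_bot_linorder)
    qed
    moreover have "filterlim (\<lambda>k. - real k + s) at_bot sequentially" for s
      by real_asymp
    ultimately have "(\<lambda>k. L (- real k + s)) \<longlonglongrightarrow> Inf (range L)" for s
      by (rule filterlim_compose)
    then show False by (rule no_limit)
  qed
  show ?thesis
  proof (rule surjI)
    fix y
    obtain a b where "L a \<le> y" "y \<le> L b" using above below by blast
    then obtain r where "L r = y"
      using lift_IVT[OF L, of a b y] le[of a b] by (metis order_trans)
    then show "L (SOME r. L r = y) = y" by (rule someI)
  qed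
qed

section \<open>Positive maps on a single circle\<close>

lemma positive_map_path:
  assumes "positive_map_of n \<sigma> F" "positive_endo n \<sigma>" "j < n"
  shows "positive_path n (\<lambda>\<theta>. F (circ j \<theta>)) 0 1"
proof -
  obtain u :: "nat \<Rightarrow> real" and h where u: "u 0 = 0" "u (length (\<sigma> j)) = 1"
    and piece: "\<And>l. l < length (\<sigma> j) \<Longrightarrow> u l < u (Suc l) \<and>
           continuous_on {u l..u (Suc l)} (h l) \<and>
           strict_mono_on {u l..u (Suc l)} (h l) \<and>
           h l (u l) = 0 \<and> h l (u (Suc l)) = 1 \<and>
           (\<forall>\<theta>\<in>{u l..u (Suc l)}. F (circ j \<theta>) = circ (\<sigma> j ! l) (h l \<theta>))"
    using assms(1,3) unfolding positive_map_of_def by metis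
  have "h l ` {u l..u (Suc l)} \<subseteq> {0..1}" if "l < length (\<sigma> j)" for l
  proof (rule image_subsetI)
    fix \<theta> assume "\<theta> \<in> {u l..u (Suc l)}"
    then show "h l \<theta> \<in> {0..1}"
      using piece[OF that] strict_mono_on_leD[of "{u l..u (Suc l)}" "h l" "u l" \<theta>]
        strict_mono_on_leD[of "{u l..u (Suc l)}" "h l" \<theta> "u (Suc l)"] by auto
  qed
  moreover have "\<sigma> j ! l < n" if "l < length (\<sigma> j)" for l
    using assms(2,3) nth_mem[OF that] unfolding positive_endo_def by (metis lessThan_iff subsetD)
  moreover have "length (\<sigma> j) \<ge> 1"
    using assms(2,3) by (cases "\<sigma> j") (auto simp: positive_endo_def)
  ultimately show ?thesis
    unfolding positive_path_def using u piece
    by (intro conjI exI[of _ "length (\<sigma> j)"] exI[of _ u] exI[of _ "\<lambda>l. \<sigma> j ! l"] exI[of _ h])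
      auto
qed

text \<open>\<open>H\<close> turns the angle on circle \<open>j\<close> into an angle of the image
  point. Being injective, it allows angles to be compared on the upper level once they agree on the
  lower one.\<close>

lemma positive_map_lift:
  assumes "positive_map_of n \<sigma> F" "positive_endo n \<sigma>" "j < n"
  obtains H where "lift n {0..1} (\<lambda>\<theta>. F (circ j \<theta>)) H" "strict_mono_on {0..1} H"
proof -
  have "continuous_on {0..1} (\<lambda>\<theta>. F (circ j \<theta>))"
    by (rule continuous_on_compose2[of "wedge n" F])
      (use assms circ_in_wedge in \<open>auto simp: positive_map_of_def circ_def
         intro!: continuous_intros continuous_on_compose2[OF continuous_on_cis]\<close>)
  moreover have "(\<lambda>\<theta>. F (circ j \<theta>)) ` {0..1} \<subseteq> wedge n"
    using assms circ_in_wedge by (fastforce simp: positive_map_of_def)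
  ultimately obtain H where "lift n {0..1} (\<lambda>\<theta>. F (circ j \<theta>)) H"
    by (rule lift_exists[OF convex_real_interval(5)])
  then show thesis
    using that positive_path_lift_strict_mono[OF positive_map_path[OF assms]] by blast
qed

lemma positive_map_initial_letter:
  assumes "positive_map_of n \<sigma> F" "\<sigma> j = c # v" "j < n"
  obtains \<delta> where "\<delta> > 0" "\<And>\<theta>. 0 \<le> \<theta> \<Longrightarrow> \<theta> \<le> \<delta> \<Longrightarrow> \<exists>\<eta>. F (circ j \<theta>) = circ c \<eta>"
proof -
  obtain u :: "nat \<Rightarrow> real" and h where u: "u 0 = 0" "u (length (\<sigma> j)) = 1"
    and piece: "\<And>l. l < length (\<sigma> j) \<Longrightarrow> u l < u (Suc l) \<and>
           (\<forall>\<theta>\<in>{u l..u (Suc l)}. F (circ j \<theta>) = circ (\<sigma> j ! l) (h l \<theta>))"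
    using assms(1,3) unfolding positive_map_of_def by metis
  show thesis
    \<comment> \<open>\<open>u 1\<close> ends the first piece, which runs along the circle of the
      first letter.\<close>
    by (rule that[of "u 1"]) (use piece[of 0] u assms(2) in auto)
qed

section \<open>Comparison of two orbits through all levels\<close>

text \<open>Two paths through a common point have angles there that differ by an integer, so one
  lift can be shifted to agree with the other.\<close>

lemma positive_line_lift_at:
  assumes "positive_line n \<gamma>" "lift n' UNIV \<gamma>' L" "\<gamma>' s = \<gamma> t"
  obtains M where "lift n UNIV \<gamma> M" "M t = L s"
proof -
  obtain M where M: "lift n UNIV \<gamma> M" using positive_line_lift_exists[OF assms(1)] .
  then have "L s - M t \<in> \<int>"
    using assms(2,3) circ_eqD unfolding lift_def by (metis UNIV_I)
  then have "lift n UNIV \<gamma> (\<lambda>r. M r + (L s - M t))" by (rule lift_shift[OF M])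
  then show thesis by (rule that) simp
qed

text \<open>As \<open>circ\<close> has period 1, the angle can be moved into the unit interval, the
  domain of \<open>H\<close>. This expresses a lift of the lower path through the angle of the upper
  one.\<close>

lemma lift_image:
  assumes H: "lift n {0..1} (\<lambda>\<theta>. F (circ j \<theta>)) H" and A: "lift n' S \<gamma> A"
    and \<gamma>: "\<And>r. r \<in> S \<Longrightarrow> \<gamma> r = circ j (A r)"
    and K: "\<And>r. r \<in> S \<Longrightarrow> A r - of_int K \<in> {0..1}"
  shows "lift n S (\<lambda>r. F (\<gamma> r)) (\<lambda>r. H (A r - of_int K))"
  unfolding lift_def
proof
  show "continuous_on S (\<lambda>r. H (A r - of_int K))"
  proof (rule continuous_on_compose2[of "{0..1}" H])
    show "continuous_on S (\<lambda>r. A r - of_int K)"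
      using A by (auto simp: lift_def intro: continuous_intros)
  qed (use H K in \<open>auto simp: lift_def\<close>)
  show "\<forall>r\<in>S. \<exists>k<n. F (\<gamma> r) = circ k (H (A r - of_int K))"
  proof
    fix r assume "r \<in> S"
    then have "F (\<gamma> r) = F (circ j (A r - of_int K))"
      by (simp add: \<gamma> circ_diff_int)
    then show "\<exists>k<n. F (\<gamma> r) = circ k (H (A r - of_int K))"
      using H K[OF \<open>r \<in> S\<close>] unfolding lift_def by simp
  qed
qed

text \<open>A path of the lower level leaves the wedge point through the circle \<open>c\<close> whatever
  circle the path of the upper level uses, because all words \<open>\<sigma> j\<close> begin with \<open>c\<close>.\<close>
lemma letter_after_wedge_point:
  assumes F: "positive_map_of n \<sigma> F" "\<And>j. j < n \<Longrightarrow> \<exists>v. \<sigma> j = c # v"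
    and \<gamma>: "positive_line n \<gamma>" "lift n UNIV \<gamma> L" and "s < t" "e < n" "\<gamma> s = 0"
    and e: "\<And>r. s \<le> r \<Longrightarrow> r \<le> t \<Longrightarrow> \<gamma> r = circ e (L r)"
    and \<gamma>': "\<And>r. \<gamma>' r = F (\<gamma> r)"
    and e': "\<And>r. s \<le> r \<Longrightarrow> r \<le> t \<Longrightarrow> \<gamma>' r = circ e' (L' r)"
    and nz: "\<And>r. s < r \<Longrightarrow> r < t \<Longrightarrow> \<gamma>' r \<noteq> 0"
  shows "e' = c"
proof -
  have less: "L r < L r' \<longleftrightarrow> r < r'" for r r' using lift_less_iff[OF \<gamma>] by auto
  have "L s \<in> \<int>" using e[of s] \<open>\<gamma> s = 0\<close> \<open>s < t\<close> circ_eq_0_iff by auto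
  then obtain K where K: "L s = of_int K" by (auto elim: Ints_cases)
  obtain \<delta> where \<delta>: "\<delta> > 0" "\<And>\<theta>. 0 \<le> \<theta> \<Longrightarrow> \<theta> \<le> \<delta> \<Longrightarrow> \<exists>\<eta>. F (circ e \<theta>) = circ c \<eta>"
    using positive_map_initial_letter[OF F(1)] F(2)[OF \<open>e < n\<close>] \<open>e < n\<close> by metis
  \<comment> \<open>An angle shortly after \<open>L s\<close>: below \<open>L t\<close>, so that it
    is reached before \<open>t\<close>, and within \<open>\<delta>\<close>, so that the image is
    still on the circle \<open>c\<close>.\<close>
  define y where "y = (L s + min (L t) (L s + \<delta>)) / 2"
  have y: "L s < y" "y < L t" "y \<le> L s + \<delta>"
    using \<delta>(1) less[of s t] \<open>s < t\<close> by (auto simp: y_def min_def)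
  obtain r where "s \<le> r" "r \<le> t" "L r = y"
    using lift_IVT[OF \<gamma>(2), of s t y] y \<open>s < t\<close> by auto
  then have r: "s < r" "r < t" using less y by auto
  have "F (\<gamma> r) = F (circ e (L r - of_int K))"
    using e[of r] r by (simp add: circ_diff_int)
  then obtain \<eta> where "F (\<gamma> r) = circ c \<eta>"
    using \<delta>(2)[of "L r - of_int K"] y \<open>L r = y\<close> K by auto
  then show ?thesis
    using circ_eq_imp_index[of e' "L' r" c \<eta>] e'[of r] nz[OF r] r by (simp add: \<gamma>')
qed

text \<open>The bound on \<open>L s\<close> keeps level 0 away from the wedge point strictly between
  \<open>s\<^sub>0\<close> and \<open>s\<close>. It is not strict, so that \<open>s\<close> may be
  the next visit and serve as the start of a further step.\<close>

lemma orbit_step: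
  fixes a b :: "nat \<Rightarrow> real \<Rightarrow> complex"
  assumes F: "\<And>i. positive_map_of n (\<sigma> i) (F i)" "\<And>i. positive_endo n (\<sigma> i)" "\<And>i. proper_endo n (\<sigma> i)"
    and a: "\<And>i. positive_line n (a i)" "\<And>i t. a i t = F i (a (Suc i) t)"
    and b: "\<And>i. positive_line n (b i)" "\<And>i t. b i t = F i (b (Suc i) t)"
    and L: "lift n UNIV (a 0) L" and M: "lift n UNIV (b 0) M"
    and start: "\<And>i. a i s\<^sub>0 = b i t\<^sub>0" "L s\<^sub>0 = M t\<^sub>0"
    and st: "s\<^sub>0 \<le> s" "L s \<le> of_int \<lfloor>L s\<^sub>0\<rfloor> + 1" "L s = M t"
  shows "a i s = b i t"
proof (cases "s = s\<^sub>0")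
  case True
  then have "t = t\<^sub>0"
    using lift_less_iff(3)[OF b(1) M] start(2) st(3) by metis
  then show ?thesis using True start by simp
next
  case False
  then have "s\<^sub>0 < s" using st by simp
  have "t\<^sub>0 < t"
    using lift_less_iff(1)[OF b(1) M] lift_less_iff(1)[OF a(1) L] start(2) st(3) \<open>s\<^sub>0 < s\<close> by metis
  have F0: "F i 0 = 0" for i using F(1)[of i] by (simp add: positive_map_of_def)
  have nonint: "y \<notin> \<int>" if "L s\<^sub>0 < y" "y < L s" for y
  proof
    assume "y \<in> \<int>"
    then obtain k where k: "y = of_int k" by (auto elim: Ints_cases)
    then have "\<lfloor>L s\<^sub>0\<rfloor> < k" using that by (simp add: floor_less_iff)
    moreover have "real_of_int k < of_int (\<lfloor>L s\<^sub>0\<rfloor> + 1)" using that st(2) k by simp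
    ultimately show False by linarith
  qed
  \<comment> \<open>\<open>F i\<close> fixes 0, so a visit to the wedge point on level
    \<open>Suc i\<close> would be one on level \<open>i\<close> and finally on level 0.\<close>
  have a_nz: "a i r \<noteq> 0" if "s\<^sub>0 < r" "r < s" for i r
  proof (induction i)
    case 0
    have "L r \<notin> \<int>" using nonint that lift_less_iff(1)[OF a(1) L] by metis
    then show ?case using L circ_eq_0_iff unfolding lift_def by (metis UNIV_I)
  next
    case (Suc i)
    then show ?case using a(2)[of i r] F0 by auto
  qed
  have b_nz: "b i r \<noteq> 0" if "t\<^sub>0 < r" "r < t" for i r
  proof (induction i)
    case 0
    have "M r \<notin> \<int>" using nonint that lift_less_iff(1)[OF b(1) M] start(2) st(3) by metis
    then show ?case using M circ_eq_0_iff unfolding lift_def by (metis UNIV_I)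
  next
    case (Suc i)
    then show ?case using b(2)[of i r] F0 by auto
  qed
  \<comment> \<open>On every level the two lifts are normalized to agree at the start; on level 0
    they have to be the given ones.\<close>
  have "\<exists>A B. lift n UNIV (a i) A \<and> lift n UNIV (b i) B \<and> A s\<^sub>0 = B t\<^sub>0 \<and> (i = 0 \<longrightarrow> A = L \<and> B = M)" for i
  proof (cases "i = 0")
    case True
    then show ?thesis using L M start(2) by blast
  next
    case False
    obtain A where A: "lift n UNIV (a i) A" using positive_line_lift_exists[OF a(1)] .
    obtain B where "lift n UNIV (b i) B" "B t\<^sub>0 = A s\<^sub>0"
      using positive_line_lift_at[OF b(1) A start(1)] .
    with A False show ?thesis by metis
  qed
  then obtain A B where A: "\<And>i. lift n UNIV (a i) (A i)" and B: "\<And>i. lift n UNIV (b i) (B i)"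
    and AB: "\<And>i. A i s\<^sub>0 = B i t\<^sub>0" and AB0: "A 0 = L" "B 0 = M" by metis
  have "\<exists>e<n. \<forall>r. s\<^sub>0 \<le> r \<and> r \<le> s \<longrightarrow> a i r = circ e (A i r) \<and> A i r - of_int \<lfloor>A i s\<^sub>0\<rfloor> \<in> {0..1}" for i
    by (rule lift_letter[OF a(1) A \<open>s\<^sub>0 < s\<close>, of i]) (use a_nz in blast)+
  then obtain e where e: "\<And>i. e i < n"
    "\<And>i r. s\<^sub>0 \<le> r \<Longrightarrow> r \<le> s \<Longrightarrow> a i r = circ (e i) (A i r)"
    "\<And>i r. s\<^sub>0 \<le> r \<Longrightarrow> r \<le> s \<Longrightarrow> A i r - of_int \<lfloor>A i s\<^sub>0\<rfloor> \<in> {0..1}" by metis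
  have "\<exists>e<n. \<forall>r. t\<^sub>0 \<le> r \<and> r \<le> t \<longrightarrow> b i r = circ e (B i r) \<and> B i r - of_int \<lfloor>B i t\<^sub>0\<rfloor> \<in> {0..1}" for i
    by (rule lift_letter[OF b(1) B \<open>t\<^sub>0 < t\<close>, of i]) (use b_nz in blast)+
  then obtain e' where e': "\<And>i. e' i < n"
    "\<And>i r. t\<^sub>0 \<le> r \<Longrightarrow> r \<le> t \<Longrightarrow> b i r = circ (e' i) (B i r)"
    "\<And>i r. t\<^sub>0 \<le> r \<Longrightarrow> r \<le> t \<Longrightarrow> B i r - of_int \<lfloor>B i t\<^sub>0\<rfloor> \<in> {0..1}" by metis
  have ee': "e i = e' i" for i
  proof (cases "a (Suc i) s\<^sub>0 = 0")
    case True
    \<comment> \<open>Both paths of level \<open>i\<close> leave the wedge point through the common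
      first letter of the words of \<open>\<sigma> i\<close>.\<close>
    obtain c where c: "\<And>j. j < n \<Longrightarrow> \<exists>v. \<sigma> i j = c # v"
      using F(3)[of i] unfolding proper_endo_def by metis
    have "e i = c"
      by (rule letter_after_wedge_point[OF F(1)[of i] c a(1) A \<open>s\<^sub>0 < s\<close> e(1) True e(2) a(2),
            where e' = "e i" and L' = "A i"])
        (use e(2) a_nz in simp_all)
    moreover have "e' i = c"
      by (rule letter_after_wedge_point[OF F(1)[of i] c b(1) B \<open>t\<^sub>0 < t\<close> e'(1) _ e'(2) b(2),
            where e' = "e' i" and L' = "B i"])
        (use e'(2) b_nz True start(1)[of "Suc i"] in simp_all)
    ultimately show ?thesis by simp
  next
    case False
    \<comment> \<open>The common starting point on level \<open>Suc i\<close> is not the wedge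
      point, so it lies on one circle only.\<close>
    have same: "e (Suc i) = e' (Suc i)"
      using circ_eq_imp_index[of "e (Suc i)" "A (Suc i) s\<^sub>0" "e' (Suc i)" "B (Suc i) t\<^sub>0"]
        e(2)[of s\<^sub>0 "Suc i"] e'(2)[of t\<^sub>0 "Suc i"] start(1)[of "Suc i"] False \<open>s\<^sub>0 < s\<close> \<open>t\<^sub>0 < t\<close>
      by simp
    note lessA = lift_less_iff(1)[OF a(1) A, of "Suc i"]
    note lessB = lift_less_iff(1)[OF b(1) B, of "Suc i"]
    \<comment> \<open>An angle after the common start and before both ends. Both upper paths reach
      it in the interior on the same circle, so their images are one nonzero point, which fixes the
      circle of level \<open>i\<close>.\<close>
    define y where "y = (A (Suc i) s\<^sub>0 + min (A (Suc i) s) (B (Suc i) t)) / 2"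
    have y: "A (Suc i) s\<^sub>0 < y" "y < A (Suc i) s" "y < B (Suc i) t"
      using lessA[of s\<^sub>0 s] lessB[of t\<^sub>0 t] AB[of "Suc i"] \<open>s\<^sub>0 < s\<close> \<open>t\<^sub>0 < t\<close>
      by (auto simp: y_def min_def)
    obtain r where "s\<^sub>0 \<le> r" "r \<le> s" "A (Suc i) r = y"
      using lift_IVT[OF A, of s\<^sub>0 s "Suc i" y] y \<open>s\<^sub>0 < s\<close> by auto
    then have r: "s\<^sub>0 < r" "r < s" "A (Suc i) r = y" using lessA y by auto
    obtain r' where "t\<^sub>0 \<le> r'" "r' \<le> t" "B (Suc i) r' = y"
      using lift_IVT[OF B, of t\<^sub>0 t "Suc i" y] y AB[of "Suc i"] \<open>t\<^sub>0 < t\<close> by auto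
    then have r': "t\<^sub>0 < r'" "r' < t" "B (Suc i) r' = y" using lessB y AB[of "Suc i"] by auto
    have "a i r = b i r'"
      unfolding a(2)[of i] b(2)[of i] using e(2)[of r "Suc i"] e'(2)[of r' "Suc i"] r r' same by simp
    then show ?thesis
      using circ_eq_imp_index[of "e i" "A i r" "e' i" "B i r'"] e(2)[of r i] e'(2)[of r' i]
        a_nz[of r i] r r' by simp
  qed
  \<comment> \<open>Induction on the level: the times matched on level 0 are matched on every
    level.\<close>
  have "A i r = B i r'" if "s\<^sub>0 \<le> r" "r \<le> s" "t\<^sub>0 \<le> r'" "r' \<le> t" "A 0 r = B 0 r'" for r r'
  proof (induction i)
    case 0
    then show ?case using that by simp
  next
    case (Suc i)
    define j where "j = e (Suc i)"
    define K where "K = \<lfloor>A (Suc i) s\<^sub>0\<rfloor>"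
    obtain H where H: "lift n {0..1} (\<lambda>\<theta>. F i (circ j \<theta>)) H" "strict_mono_on {0..1} H"
      using positive_map_lift[OF F(1,2) e(1)] unfolding j_def by blast
    have "lift n {s\<^sub>0..s} (\<lambda>r. F i (a (Suc i) r)) (\<lambda>r. H (A (Suc i) r - of_int K))"
      by (rule lift_image[OF H(1) lift_subset[OF A]])
        (use e(2,3)[of _ "Suc i"] in \<open>auto simp: j_def K_def\<close>)
    then have liftA: "lift n {s\<^sub>0..s} (a i) (\<lambda>r. H (A (Suc i) r - of_int K))"
      by (rule lift_cong[rotated]) (rule a(2)[symmetric])
    \<comment> \<open>The lift through \<open>H\<close> and the lift \<open>A i\<close> differ by a
      constant, evaluated at the start. The constant for \<open>B i\<close> is the same, as the
      starting angles agree.\<close>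
    have 1: "H (A (Suc i) r - of_int K) - A i r = H (A (Suc i) s\<^sub>0 - of_int K) - A i s\<^sub>0"
      by (rule lift_unique[OF _ liftA lift_subset[OF A]]) (use that \<open>s\<^sub>0 < s\<close> in auto)
    have "lift n {t\<^sub>0..t} (\<lambda>r. F i (b (Suc i) r)) (\<lambda>r. H (B (Suc i) r - of_int K))"
      by (rule lift_image[OF H(1) lift_subset[OF B]])
        (use e'(2,3)[of _ "Suc i"] AB[of "Suc i"] ee'[of "Suc i"] in \<open>auto simp: j_def K_def\<close>)
    then have liftB: "lift n {t\<^sub>0..t} (b i) (\<lambda>r. H (B (Suc i) r - of_int K))"
      by (rule lift_cong[rotated]) (rule b(2)[symmetric])
    have "H (B (Suc i) r' - of_int K) - B i r' = H (B (Suc i) t\<^sub>0 - of_int K) - B i t\<^sub>0"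
      by (rule lift_unique[OF _ liftB lift_subset[OF B]]) (use that \<open>t\<^sub>0 < t\<close> in auto)
    with 1 Suc.IH AB have "H (A (Suc i) r - of_int K) = H (B (Suc i) r' - of_int K)" by simp
    moreover have "A (Suc i) r - of_int K \<in> {0..1}" "B (Suc i) r' - of_int K \<in> {0..1}"
      using e(3)[of r "Suc i"] e'(3)[of r' "Suc i"] AB that by (simp_all add: K_def)
    ultimately show ?case
      using strict_mono_on_imp_inj_on[OF H(2)] by (auto dest: inj_onD)
  qed
  from this[of s t] have "A i s = B i t"
    using \<open>s\<^sub>0 < s\<close> \<open>t\<^sub>0 < t\<close> st(3) AB0 by simp
  then show ?thesis
    using e(2)[of s i] e'(2)[of t i] ee' \<open>s\<^sub>0 < s\<close> \<open>t\<^sub>0 < t\<close> by simp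
qed

text \<open>Steps are chained at the integers passed by \<open>L\<close>; at each of them all levels
  agree again, which is the starting condition of the next step. Surjectivity of \<open>M\<close>
  provides the matching time on the second orbit.\<close>

lemma orbit_forward:
  fixes a b :: "nat \<Rightarrow> real \<Rightarrow> complex"
  assumes F: "\<And>i. positive_map_of n (\<sigma> i) (F i)" "\<And>i. positive_endo n (\<sigma> i)" "\<And>i. proper_endo n (\<sigma> i)"
    and a: "\<And>i. positive_line n (a i)" "\<And>i t. a i t = F i (a (Suc i) t)"
    and b: "\<And>i. positive_line n (b i)" "\<And>i t. b i t = F i (b (Suc i) t)"
    and L: "lift n UNIV (a 0) L" and M: "lift n UNIV (b 0) M" "surj M"
    and start: "\<And>i. a i s\<^sub>0 = b i t\<^sub>0" "L s\<^sub>0 = M t\<^sub>0"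
    and st: "s\<^sub>0 \<le> s" "L s = M t"
  shows "a i s = b i t"
proof -
  define k where "k = \<lfloor>L s\<^sub>0\<rfloor>"
  note step = orbit_step[OF F a b L M(1)]
  have claim: "\<forall>i. a i s = b i t" if "s\<^sub>0 \<le> s" "L s \<le> of_int k + real N + 1" "L s = M t" for N s t
    using that
  proof (induction N arbitrary: s t)
    case 0
    then show ?case using step[OF start] by (simp add: k_def)
  next
    case (Suc N)
    show ?case
    proof (cases "L s \<le> of_int k + real N + 1")
      case True
      then show ?thesis using Suc by blast
    next
      case False
      have "L s\<^sub>0 < of_int k + 1" unfolding k_def by linarith
      then have "L s\<^sub>0 \<le> of_int k + real N + 1" by simp
      then obtain r where r: "s\<^sub>0 \<le> r" "r \<le> s" "L r = of_int k + real N + 1"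
        using lift_IVT[OF L, of s\<^sub>0 s "of_int k + real N + 1"] False Suc.prems(1) by auto
      obtain r' where r': "L r = M r'" using M(2) by (metis surjD)
      have "\<forall>i. a i r = b i r'" using Suc.IH[of r r'] r r' by simp
      moreover have "\<lfloor>L r\<rfloor> = k + int N + 1" using r(3) by linarith
      then have "L s \<le> of_int \<lfloor>L r\<rfloor> + 1" using Suc.prems(2) by simp
      ultimately show ?thesis using step[of r r' s t] r r' Suc.prems(3) by blast
    qed
  qed
  obtain N :: nat where "L s - of_int k - 1 \<le> real N" using real_arch_simple by blast
  then have "L s \<le> of_int k + real N + 1" by simp
  from claim[OF st(1) this st(2)] show ?thesis by simp
qed

section \<open>Transport of expansions and removal of initial symbols\<close>

text \<open>A flow equivalence changes the time along orbits. Near \<open>t\<close> the changed path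
  can meet the wedge point only at \<open>t\<close>, so two pieces, before and after
  \<open>t\<close>, suffice.\<close>

lemma positive_line_comp:
  fixes T :: "real \<Rightarrow> real"
  assumes \<gamma>: "positive_line n \<gamma>" and T: "continuous_on UNIV T" "strict_mono T"
  shows "positive_line n (\<lambda>t. \<gamma> (T t))"
proof -
  obtain L where L: "lift n UNIV \<gamma> L" using positive_line_lift_exists[OF \<gamma>] .
  define N where "N t = L (T t)" for t
  have less: "N s < N t \<longleftrightarrow> s < t" "N s \<le> N t \<longleftrightarrow> s \<le> t" for s t
    using lift_less_iff[OF \<gamma> L] T(2) by (simp_all add: N_def strict_mono_less strict_mono_less_eq)
  have cont: "continuous_on UNIV N"
    unfolding N_def using L continuous_on_compose2[OF _ T(1), of UNIV L] by (simp add: lift_def)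
  have letter: "\<exists>j<n. \<forall>r. s \<le> r \<and> r \<le> t \<longrightarrow> \<gamma> (T r) = circ j (N r) \<and> N r - of_int \<lfloor>N s\<rfloor> \<in> {0..1}"
    if "s < t" and between: "of_int k \<le> N s" "N t \<le> of_int k + 1" for s t k
  proof -
    have "\<gamma> r \<noteq> 0" if "T s < r" "r < T t" for r
    proof -
      have "of_int k < L r" "L r < of_int k + 1"
        using that between lift_less_iff(1)[OF \<gamma> L, of "T s" r] lift_less_iff(1)[OF \<gamma> L, of r "T t"]
        unfolding N_def by linarith+
      then have "L r \<notin> \<int>" by (auto elim!: Ints_cases)
      then show ?thesis using L circ_eq_0_iff unfolding lift_def by (metis UNIV_I)
    qed
    moreover have "T s < T t" using T(2) \<open>s < t\<close> by (simp add: strict_mono_less)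
    ultimately obtain j where "j < n" "\<And>r. T s \<le> r \<Longrightarrow> r \<le> T t \<Longrightarrow> \<gamma> r = circ j (L r)"
      "\<And>r. T s \<le> r \<Longrightarrow> r \<le> T t \<Longrightarrow> L r - of_int \<lfloor>L (T s)\<rfloor> \<in> {0..1}"
      using lift_letter[OF \<gamma> L] by metis
    then show ?thesis
      using T(2) unfolding N_def by (metis strict_mono_less_eq)
  qed
  have "\<exists>\<epsilon>>0. positive_path n (\<lambda>t. \<gamma> (T t)) (t - \<epsilon>) (t + \<epsilon>)" for t
  proof -
    have "isCont N t" using cont by (simp add: continuous_on_eq_continuous_at)
    \<comment> \<open>The distance from \<open>N t\<close> to the nearest integer different from
      it.\<close>
    moreover define \<delta> where "\<delta> = min (N t - of_int (\<lceil>N t\<rceil> - 1)) (of_int (\<lfloor>N t\<rfloor> + 1) - N t)"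
    moreover have "\<delta> > 0" unfolding \<delta>_def by (simp add: algebra_simps) linarith
    ultimately obtain d where d: "d > 0" "\<And>s. \<bar>s - t\<bar> < d \<Longrightarrow> \<bar>N s - N t\<bar> < \<delta>"
      unfolding continuous_at_eps_delta dist_real_def by metis
    define \<epsilon> where "\<epsilon> = d / 2"
    have \<epsilon>: "\<epsilon> > 0" using d(1) by (simp add: \<epsilon>_def)
    define u where "u l = t - \<epsilon> + \<epsilon> * real l" for l
    have u: "u 0 = t - \<epsilon>" "u (Suc 0) = t" "u 2 = t + \<epsilon>" "u l < u (Suc l)" for l
      using \<epsilon> by (simp_all add: u_def algebra_simps)
    have "\<bar>N (t - \<epsilon>) - N t\<bar> < \<delta>" "\<bar>N (t + \<epsilon>) - N t\<bar> < \<delta>"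
      using d by (simp_all add: \<epsilon>_def)
    then have bounds: "of_int (\<lceil>N t\<rceil> - 1) \<le> N (t - \<epsilon>)" "N (t + \<epsilon>) \<le> of_int \<lfloor>N t\<rfloor> + 1"
      unfolding \<delta>_def by linarith+
    have "\<exists>j<n. \<forall>r. u l \<le> r \<and> r \<le> u (Suc l) \<longrightarrow>
        \<gamma> (T r) = circ j (N r) \<and> N r - of_int \<lfloor>N (u l)\<rfloor> \<in> {0..1}" if "l < 2" for l
    proof -
      consider "l = 0" | "l = 1" using \<open>l < 2\<close> by linarith
      then show ?thesis
      proof cases
        case 1
        show ?thesis
          by (rule letter[where k = "\<lceil>N t\<rceil> - 1"]) (use u bounds 1 \<epsilon> in auto)
      next
        case 2
        show ?thesis
          by (rule letter[where k = "\<lfloor>N t\<rfloor>"]) (use u bounds 2 \<epsilon> in \<open>auto simp: numeral_2_eq_2\<close>)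
      qed
    qed
    then obtain c where c: "\<And>l. l < 2 \<Longrightarrow> c l < n"
      "\<And>l r. l < 2 \<Longrightarrow> u l \<le> r \<Longrightarrow> r \<le> u (Suc l) \<Longrightarrow> \<gamma> (T r) = circ (c l) (N r)"
      "\<And>l r. l < 2 \<Longrightarrow> u l \<le> r \<Longrightarrow> r \<le> u (Suc l) \<Longrightarrow> N r - of_int \<lfloor>N (u l)\<rfloor> \<in> {0..1}"
      by metis
    \<comment> \<open>Subtracting an integer brings the angle into the unit interval without moving
      the point on its circle.\<close>
    define h where "h l r = N r - of_int \<lfloor>N (u l)\<rfloor>" for l r
    have "u l < u (Suc l) \<and> c l < n \<and> continuous_on {u l..u (Suc l)} (h l) \<and>
        strict_mono_on {u l..u (Suc l)} (h l) \<and> h l ` {u l..u (Suc l)} \<subseteq> {0..1} \<and>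
        (\<forall>s\<in>{u l..u (Suc l)}. \<gamma> (T s) = circ (c l) (h l s))" if "l < 2" for l
    proof (intro conjI)
      show "h l ` {u l..u (Suc l)} \<subseteq> {0..1}"
        using c(3)[OF that] unfolding h_def by (meson atLeastAtMost_iff image_subsetI)
      show "\<forall>s\<in>{u l..u (Suc l)}. \<gamma> (T s) = circ (c l) (h l s)"
        using c(2)[OF that] unfolding h_def circ_diff_int by simp
      show "continuous_on {u l..u (Suc l)} (h l)"
        unfolding h_def by (intro continuous_intros continuous_on_subset[OF cont]) auto
      show "strict_mono_on {u l..u (Suc l)} (h l)"
        using less by (auto simp: strict_mono_on_def h_def)
    qed (use u c(1)[OF that] in auto)
    then have piece: "\<forall>l<2. u l < u (Suc l) \<and> c l < n \<and> continuous_on {u l..u (Suc l)} (h l) \<and>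
        strict_mono_on {u l..u (Suc l)} (h l) \<and> h l ` {u l..u (Suc l)} \<subseteq> {0..1} \<and>
        (\<forall>s\<in>{u l..u (Suc l)}. \<gamma> (T s) = circ (c l) (h l s))" by blast
    have "positive_path n (\<lambda>t. \<gamma> (T t)) (t - \<epsilon>) (t + \<epsilon>)"
      unfolding positive_path_def
      by (intro conjI exI[of _ 2] exI[of _ u] exI[of _ c] exI[of _ h] piece u(1,3)) (use \<epsilon> in simp_all)
    then show ?thesis using \<epsilon> by blast
  qed
  moreover have "continuous_on UNIV (\<lambda>t. \<gamma> (T t))" "range (\<lambda>t. \<gamma> (T t)) \<subseteq> wedge n"
    using \<gamma> continuous_on_compose2[OF _ T(1), of UNIV \<gamma>] by (auto simp: positive_line_def)
  ultimately show ?thesis by (simp add: positive_line_def)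
qed

lemma is_flow_orbit_continuous:
  assumes "is_flow \<phi>"
  shows "continuous_on UNIV (\<lambda>t. \<phi> t x)"
proof -
  have "continuous_on UNIV ((\<lambda>(t, x). \<phi> t x) \<circ> (\<lambda>t. (t, x)))"
    using assms by (intro continuous_on_compose continuous_intros)
      (auto simp: is_flow_def intro: continuous_on_subset)
  then show ?thesis by (simp add: o_def)
qed

lemma expansion_positive_line:
  assumes "is_flow \<phi>" "continuous_on UNIV p" "range p = wedge n"
    and "\<And>x t. \<exists>\<epsilon>>0. positive_path n (\<lambda>\<tau>. p (\<phi> \<tau> x)) (t - \<epsilon>) (t + \<epsilon>)"
  shows "positive_line n (\<lambda>t. p (\<phi> t x))"
  using assms continuous_on_compose2[OF assms(2) is_flow_orbit_continuous[OF assms(1)]]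
  by (auto simp: positive_line_def)

text \<open>All projections are composed with \<open>h\<close>, and the base point is pulled back.
  The inverse limit is unchanged; only positivity along the orbits of \<open>\<phi>\<close> needs
  \<open>positive_line_comp\<close>.\<close>

lemma admissible_expansion_transfer:
  fixes \<phi> :: "real \<Rightarrow> 'a::metric_space \<Rightarrow> 'a" and \<psi> :: "real \<Rightarrow> 'b::metric_space \<Rightarrow> 'b"
  assumes "flow_equivalent \<phi> \<psi>" "is_flow \<psi>" and exp: "admissible_expansion n m f \<psi> s"
  shows "admissible_expansion n m f \<phi> s"
proof -
  obtain h g where hg: "homeomorphism UNIV UNIV h g"
    and T: "\<And>x. \<exists>T::real \<Rightarrow> real. continuous_on UNIV T \<and> strict_mono T \<and> T 0 = 0 \<and>
              (\<forall>t. h (\<phi> t x) = \<psi> (T t) (h x))"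
    using assms(1) unfolding flow_equivalent_def by blast
  obtain y q k where s: "\<And>i. s i < m"
    and q: "\<And>i. continuous_on UNIV (q i)" "\<And>i. range (q i) = wedge n" "\<And>i. q i y = 0"
    and pos: "\<And>i x t. \<exists>\<epsilon>>0. positive_path n (\<lambda>\<tau>. q i (\<psi> \<tau> x)) (t - \<epsilon>) (t + \<epsilon>)"
    and comm: "\<And>i x. q i x = f (s i) (q (Suc i) x)"
    and k: "homeomorphism UNIV {z. \<forall>i. z i \<in> wedge n \<and> z i = f (s i) (z (Suc i))} (\<lambda>x i. q i x) k"
    using exp unfolding admissible_expansion_def by blast
  have "continuous_on UNIV (\<lambda>x. q i (h x))" for i
    using continuous_on_compose2[OF q(1) homeomorphism_cont1[OF hg]] by simp
  moreover have "range (\<lambda>x. q i (h x)) = wedge n" for i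
    using q(2)[of i] homeomorphism_image1[OF hg] by (metis image_image)
  moreover have "q i (h (g y)) = 0" for i
    using q(3) hg by (simp add: homeomorphism_def)
  moreover have "\<exists>\<epsilon>>0. positive_path n (\<lambda>\<tau>. q i (h (\<phi> \<tau> x))) (t - \<epsilon>) (t + \<epsilon>)" for i x t
  proof -
    obtain T :: "real \<Rightarrow> real" where "continuous_on UNIV T" "strict_mono T"
      and eq: "\<And>t. h (\<phi> t x) = \<psi> (T t) (h x)" using T by blast
    then have "positive_line n (\<lambda>t. q i (\<psi> (T t) (h x)))"
      using positive_line_comp[OF expansion_positive_line[OF assms(2) q(1,2) pos]] by blast
    then show ?thesis by (simp add: positive_line_def eq)
  qed
  moreover have "homeomorphism UNIV {z. \<forall>i. z i \<in> wedge n \<and> z i = f (s i) (z (Suc i))}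
      (\<lambda>x i. q i (h x)) (g \<circ> k)"
    using homeomorphism_compose[OF hg k] by (simp add: o_def)
  ultimately show ?thesis
    unfolding admissible_expansion_def using s comm
    by (intro conjI exI[of _ "g y"] exI[of _ "\<lambda>i x. q i (h x)"]) blast+
qed

text \<open>Level 0 is the image of level 1, so forgetting it keeps the points separated.
  Compactness makes the resulting continuous bijection a homeomorphism.\<close>

lemma admissible_expansion_Suc:
  fixes \<phi> :: "real \<Rightarrow> 'a::metric_space \<Rightarrow> 'a"
  assumes "compact (UNIV :: 'a set)" "\<forall>i<m. positive_map_of n (\<sigma> i) (f i)"
    and exp: "admissible_expansion n m f \<phi> s"
  shows "admissible_expansion n m f \<phi> (\<lambda>i. s (Suc i))"
proof -
  obtain x p k where s: "\<And>i. s i < m"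
    and p: "\<And>i. continuous_on UNIV (p i)" "\<And>i. range (p i) = wedge n" "\<And>i. p i x = 0"
    and pos: "\<And>i x t. \<exists>\<epsilon>>0. positive_path n (\<lambda>\<tau>. p i (\<phi> \<tau> x)) (t - \<epsilon>) (t + \<epsilon>)"
    and comm: "\<And>i x. p i x = f (s i) (p (Suc i) x)"
    and k: "homeomorphism UNIV {z. \<forall>i. z i \<in> wedge n \<and> z i = f (s i) (z (Suc i))} (\<lambda>x i. p i x) k"
    using exp unfolding admissible_expansion_def by blast
  have F: "f (s i) ` wedge n = wedge n" for i
    using assms(2) s by (simp add: positive_map_of_def)
  have "\<exists>g. homeomorphism UNIV {z. \<forall>i. z i \<in> wedge n \<and> z i = f (s (Suc i)) (z (Suc i))}
      (\<lambda>x i. p (Suc i) x) g"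
  proof (rule homeomorphism_compact)
    show "continuous_on UNIV (\<lambda>x i. p (Suc i) x)"
      using p(1) by (intro continuous_on_coordinatewise_then_product) auto
    show "range (\<lambda>x i. p (Suc i) x) = {z. \<forall>i. z i \<in> wedge n \<and> z i = f (s (Suc i)) (z (Suc i))}"
    proof (intro equalityI subsetI)
      fix z assume "z \<in> range (\<lambda>x i. p (Suc i) x)"
      then obtain w where z: "z = (\<lambda>i. p (Suc i) w)" by blast
      have "p (Suc i) w \<in> wedge n" for i using p(2) by blast
      moreover have "p (Suc i) w = f (s (Suc i)) (p (Suc (Suc i)) w)" for i by (rule comm)
      ultimately show "z \<in> {z. \<forall>i. z i \<in> wedge n \<and> z i = f (s (Suc i)) (z (Suc i))}"
        unfolding z by blast
    next
      fix z assume z: "z \<in> {z. \<forall>i. z i \<in> wedge n \<and> z i = f (s (Suc i)) (z (Suc i))}"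
      \<comment> \<open>A thread of the shifted sequence is extended downwards by the first bonding
        map.\<close>
      define z' where "z' i = (case i of 0 \<Rightarrow> f (s 0) (z 0) | Suc i \<Rightarrow> z i)" for i
      have "z' i \<in> wedge n \<and> z' i = f (s i) (z' (Suc i))" for i
      proof (cases i)
        case 0
        have "z 0 \<in> wedge n" using z by blast
        then show ?thesis using F[of 0] 0 by (auto simp: z'_def)
      next
        case (Suc j)
        then show ?thesis unfolding z'_def Suc nat.case using z by blast
      qed
      then have "z' \<in> range (\<lambda>x i. p i x)"
        unfolding homeomorphism_image1[OF k] by (intro CollectI allI)
      then obtain w where w: "z' = (\<lambda>i. p i w)" by blast
      have "z = (\<lambda>i. p (Suc i) w)"
      proof
        fix i show "z i = p (Suc i) w" using fun_cong[OF w, of "Suc i"] by (simp add: z'_def)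
      qed
      then show "z \<in> range (\<lambda>x i. p (Suc i) x)" by blast
    qed
    show "inj (\<lambda>x i. p (Suc i) x)"
    proof (rule injI)
      fix v w assume eq: "(\<lambda>i. p (Suc i) v) = (\<lambda>i. p (Suc i) w)"
      have "(\<lambda>i. p i v) = (\<lambda>i. p i w)"
      proof
        fix i show "p i v = p i w"
          using comm[of i v] comm[of i w] fun_cong[OF eq, of i] by simp
      qed
      then show "v = w" using homeomorphism_apply1[OF k] by (metis UNIV_I)
    qed
  qed (rule assms(1))
  then show ?thesis
    unfolding admissible_expansion_def using s p pos comm
    by (intro conjI exI[of _ x] exI[of _ "\<lambda>i. p (Suc i)"]) blast+
qed

lemma admissible_expansion_drop:
  fixes \<phi> :: "real \<Rightarrow> 'a::metric_space \<Rightarrow> 'a"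
  assumes "compact (UNIV :: 'a set)" "\<forall>i<m. positive_map_of n (\<sigma> i) (f i)"
    and "admissible_expansion n m f \<phi> s"
  shows "admissible_expansion n m f \<phi> (\<lambda>i. s (k + i))"
  using assms(3)
proof (induction k arbitrary: s)
  case (Suc k)
  then show ?case
    using Suc.IH[OF admissible_expansion_Suc[OF assms(1,2) Suc.prems]] by simp
qed simp

section \<open>Flow equivalence of spaces with equal symbol sequences\<close>

lemma same_symbols_imp_flow_equivalent:
  fixes \<phi> :: "real \<Rightarrow> 'a::metric_space \<Rightarrow> 'a" and \<psi> :: "real \<Rightarrow> 'b::metric_space \<Rightarrow> 'b"
  assumes endos: "\<forall>i<m. positive_endo n (\<sigma> i) \<and> proper_endo n (\<sigma> i)"
    and maps: "\<forall>i<m. positive_map_of n (\<sigma> i) (f i)"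
    and X: "compact (UNIV :: 'a set)" "is_flow \<phi>" "admissible_expansion n m f \<phi> s"
    and Y: "compact (UNIV :: 'b set)" "is_flow \<psi>" "admissible_expansion n m f \<psi> s"
  shows "flow_equivalent \<phi> \<psi>"
proof -
  let ?lim = "{z. \<forall>i. z i \<in> wedge n \<and> z i = f (s i) (z (Suc i))}"
  obtain x\<^sub>0 p gX where s: "\<And>i. s i < m"
    and p: "\<And>i. continuous_on UNIV (p i)" "\<And>i. range (p i) = wedge n" "\<And>i. p i x\<^sub>0 = 0"
    and posX: "\<And>i x t. \<exists>\<epsilon>>0. positive_path n (\<lambda>\<tau>. p i (\<phi> \<tau> x)) (t - \<epsilon>) (t + \<epsilon>)"
    and commX: "\<And>i x. p i x = f (s i) (p (Suc i) x)"
    and gX: "homeomorphism UNIV ?lim (\<lambda>x i. p i x) gX"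
    using X(3) unfolding admissible_expansion_def by blast
  obtain y\<^sub>0 q gY where q: "\<And>i. continuous_on UNIV (q i)" "\<And>i. range (q i) = wedge n" "\<And>i. q i y\<^sub>0 = 0"
    and posY: "\<And>i x t. \<exists>\<epsilon>>0. positive_path n (\<lambda>\<tau>. q i (\<psi> \<tau> x)) (t - \<epsilon>) (t + \<epsilon>)"
    and commY: "\<And>i x. q i x = f (s i) (q (Suc i) x)"
    and gY: "homeomorphism UNIV ?lim (\<lambda>x i. q i x) gY"
    using Y(3) unfolding admissible_expansion_def by blast
  note lineX = expansion_positive_line[OF X(2) p(1,2) posX]
  note lineY = expansion_positive_line[OF Y(2) q(1,2) posY]
  have addX: "\<phi> s (\<phi> t x) = \<phi> (s + t) x" and addY: "\<psi> s (\<psi> t y) = \<psi> (s + t) y"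
    and zeroX: "\<phi> 0 x = x" and zeroY: "\<psi> 0 y = y" for s t x y
    using X(2) Y(2) by (simp_all add: is_flow_def)
  \<comment> \<open>\<open>h x\<close> is the point of the second space with the same thread as
    \<open>x\<close> in the common inverse limit.\<close>
  define h where "h x = gY (\<lambda>i. p i x)" for x
  have homeo: "homeomorphism UNIV UNIV h (\<lambda>y. gX (\<lambda>i. q i y))"
    using homeomorphism_compose[OF gX homeomorphism_symD[OF gY]] by (simp add: o_def h_def[abs_def])
  have qh: "q i (h x) = p i x" for i x
  proof -
    have "(\<lambda>i. p i x) \<in> ?lim"
      unfolding homeomorphism_image1[OF gX, symmetric] by (rule rangeI)
    from homeomorphism_apply2[OF gY this] show ?thesis unfolding h_def by (rule fun_cong)
  qed
  have q_inj: "v = w" if "\<And>i. q i v = q i w" for v w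
  proof -
    have "(\<lambda>i. q i v) = (\<lambda>i. q i w)" using that by (rule ext)
    then have "gY (\<lambda>i. q i v) = gY (\<lambda>i. q i w)" by (rule arg_cong)
    then show ?thesis by (simp only: homeomorphism_apply1[OF gY UNIV_I])
  qed
  have surjL: "surj L" if "lift n UNIV (\<lambda>t. p i (\<phi> t x)) L" for i x L
    by (rule surj_lift[OF X(1,2) p(1) lineX that])
  have surjM: "surj M" if "lift n UNIV (\<lambda>t. q i (\<psi> t y)) M" for i y M
    by (rule surj_lift[OF Y(1,2) q(1) lineY that])

  have forward: "h (\<phi> r x) = \<psi> t (h x)"
    if L: "lift n UNIV (\<lambda>t. p 0 (\<phi> t x)) L" and M: "lift n UNIV (\<lambda>t. q 0 (\<psi> t (h x))) M"
      and "L 0 = M 0" "0 \<le> r" "L r = M t" for x L M r t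
  proof (rule q_inj)
    fix i
    have "p i (\<phi> r x) = q i (\<psi> t (h x))"
      by (rule orbit_forward[where \<sigma> = "\<lambda>i. \<sigma> (s i)" and F = "\<lambda>i. f (s i)"
            and a = "\<lambda>i t. p i (\<phi> t x)" and b = "\<lambda>i t. q i (\<psi> t (h x))" and s\<^sub>0 = 0 and t\<^sub>0 = 0,
            OF _ _ _ lineX commX lineY commY L M surjM[OF M]])
        (use endos maps s that qh in \<open>simp_all add: zeroX zeroY\<close>)
    then show "q i (h (\<phi> r x)) = q i (\<psi> t (h x))" by (simp add: qh)
  qed

  have all_times: "h (\<phi> r x) = \<psi> t (h x)"
    if L: "lift n UNIV (\<lambda>t. p 0 (\<phi> t x)) L" and M: "lift n UNIV (\<lambda>t. q 0 (\<psi> t (h x))) M"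
      and LM: "L 0 = M 0" "L r = M t" for x L M r t
  proof (cases "0 \<le> r")
    case True
    then show ?thesis using forward that by blast
  next
    case False
    \<comment> \<open>For negative \<open>r\<close> the comparison starts at
      \<open>\<phi> r x\<close> and its image \<open>y\<close>, and runs forward to
      \<open>x\<close>.\<close>
    define y where "y = h (\<phi> r x)"
    have L': "lift n UNIV (\<lambda>t. p 0 (\<phi> t (\<phi> r x))) (\<lambda>t. L (t + r))"
      using lift_translate[OF L, of r] by (simp add: addX)
    obtain M' where M': "lift n UNIV (\<lambda>t. q 0 (\<psi> t y)) M'" "M' 0 = L (0 + r)"
      by (rule positive_line_lift_at[where \<gamma> = "\<lambda>t. q 0 (\<psi> t y)" and s = 0 and t = 0, OF lineY L'])
         (simp_all add: y_def qh zeroX zeroY)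
    \<comment> \<open>\<open>D\<close> is the time at which the orbit of \<open>y\<close> has the
      angle that the orbit of \<open>\<phi> r x\<close> has on reaching \<open>x\<close>, so
      \<open>h x\<close> is found there.\<close>
    obtain D where D: "M' D = L 0" using surjM[OF M'(1)] by (metis surjD)
    have "h (\<phi> (- r) (\<phi> r x)) = \<psi> D y"
      unfolding y_def by (rule forward[OF L' M'(1)[unfolded y_def]]) (use M'(2) D False in auto)
    then have hx: "h x = \<psi> D y" by (simp add: addX zeroX)
    have M'': "lift n UNIV (\<lambda>t. q 0 (\<psi> t (h x))) (\<lambda>t. M' (t + D))"
      using lift_translate[OF M'(1), of D] by (simp add: addY hx)
    \<comment> \<open>Two lifts along the orbit of \<open>h x\<close>. They agree at time 0, where
      both equal \<open>L 0\<close>, hence also at \<open>- D\<close>, where the value is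
      \<open>L r\<close>.\<close>
    have "M' (- D + D) - M (- D) = M' (0 + D) - M 0"
      by (rule lift_unique[OF connected_UNIV M'' M]) auto
    then have "M (- D) = M t" using D LM M'(2) by simp
    then have "t = - D" using lift_less_iff(3)[OF lineY M] by metis
    then show ?thesis by (simp add: hx addY zeroY y_def)
  qed

  have "\<exists>\<tau>. continuous_on UNIV \<tau> \<and> strict_mono \<tau> \<and> surj \<tau> \<and> \<tau> 0 = 0 \<and> (\<forall>t. h (\<phi> t x) = \<psi> (\<tau> t) (h x))" for x
  proof -
    obtain L where L: "lift n UNIV (\<lambda>t. p 0 (\<phi> t x)) L" using positive_line_lift_exists[OF lineX] .
    obtain M where M: "lift n UNIV (\<lambda>t. q 0 (\<psi> t (h x))) M" "M 0 = L 0"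
      by (rule positive_line_lift_at[where \<gamma> = "\<lambda>t. q 0 (\<psi> t (h x))" and s = 0 and t = 0, OF lineY L])
         (simp_all add: qh zeroX zeroY)
    \<comment> \<open>The time change that matches the angles on level 0.\<close>
    define \<tau> where "\<tau> t = inv M (L t)" for t
    have M\<tau>: "M (\<tau> t) = L t" for t
      unfolding \<tau>_def using surjM[OF M(1)] by (rule surj_f_inv_f)
    note L_less = lift_less_iff[OF lineX L] and M_less = lift_less_iff[OF lineY M(1)]
    have mono: "strict_mono \<tau>"
      by (rule strict_monoI) (metis L_less(1) M_less(1) M\<tau>)
    have surj: "surj \<tau>"
    proof (rule surjI)
      fix t show "\<tau> (inv L (M t)) = t"
        using M\<tau> surj_f_inv_f[OF surjL[OF L]] M_less(3) by metis
    qed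
    \<comment> \<open>A monotone surjection of the line has no jumps.\<close>
    have "continuous_on UNIV \<tau>"
      by (rule continuous_onI_mono) (use mono surj in \<open>auto simp: strict_mono_less_eq\<close>)
    moreover have "\<tau> 0 = 0" using M\<tau>[of 0] M(2) M_less(3) by metis
    ultimately show ?thesis
      using mono surj all_times[OF L M(1)] M(2) M\<tau> by metis
  qed
  then obtain \<tau> where \<tau>: "\<And>x. continuous_on UNIV (\<tau> x)" "\<And>x. strict_mono (\<tau> x)" "\<And>x. surj (\<tau> x)"
    "\<And>x. \<tau> x 0 = 0" "\<And>x t. h (\<phi> t x) = \<psi> (\<tau> x t) (h x)" by metis
  have "h ` orbit \<phi> x = orbit \<psi> (h x)" for x
  \<comment> \<open>Surjectivity of the time change gives the whole target orbit and not only a part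
    of it.\<close>
  proof -
    have "h ` orbit \<phi> x = (\<lambda>t. \<psi> t (h x)) ` range (\<tau> x)"
      by (simp add: orbit_def image_image \<tau>(5))
    then show ?thesis by (simp add: orbit_def \<tau>(3))
  qed
  then show ?thesis
    unfolding flow_equivalent_def using homeo \<tau> by blast
qed

section \<open>Flow equivalence and tail equivalence of symbol sequences\<close>

theorem theorem8p8:
  fixes n m :: nat
    and \<sigma> :: "nat \<Rightarrow> nat \<Rightarrow> nat list"
    and f :: "nat \<Rightarrow> complex \<Rightarrow> complex"
    and \<phi> :: "real \<Rightarrow> 'a::metric_space \<Rightarrow> 'a"
    and \<psi> :: "real \<Rightarrow> 'b::metric_space \<Rightarrow> 'b"
  assumes endos: "\<forall>i<m. positive_endo n (\<sigma> i) \<and> proper_endo n (\<sigma> i) \<and> primitive_endo n (\<sigma> i)"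
    and free: "freely_generate n m (\<lambda>i. abel_mat n (\<sigma> i))"
    and maps: "\<forall>i<m. positive_map_of n (\<sigma> i) (f i)"
    and X: "flow_space \<phi>" "\<exists>s. admissible_expansion n m f \<phi> s"
    and Y: "flow_space \<psi>" "\<exists>t. admissible_expansion n m f \<psi> t"
  shows "flow_equivalent \<phi> \<psi> \<longleftrightarrow>
           (\<exists>s t. admissible_expansion n m f \<phi> s \<and> admissible_expansion n m f \<psi> t \<and>
                  tail_equivalent s t)"
proof
  assume "flow_equivalent \<phi> \<psi>"
  \<comment> \<open>An expansion of \<open>\<psi>\<close> transfers to \<open>\<phi>\<close> with
    the same symbols, so one sequence serves for both.\<close>
  then show "\<exists>s t. admissible_expansion n m f \<phi> s \<and> admissible_expansion n m f \<psi> t \<and> tail_equivalent s t"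
    using Y admissible_expansion_transfer[of \<phi> \<psi>]
    unfolding flow_space_def tail_equivalent_def by blast
next
  assume "\<exists>s t. admissible_expansion n m f \<phi> s \<and> admissible_expansion n m f \<psi> t \<and> tail_equivalent s t"
  then obtain s t k l where s: "admissible_expansion n m f \<phi> s"
    and t: "admissible_expansion n m f \<psi> t" and kl: "\<And>j. s (k + j) = t (l + j)"
    unfolding tail_equivalent_def by blast
  have "compact (UNIV :: 'a set)" "is_flow \<phi>" "compact (UNIV :: 'b set)" "is_flow \<psi>"
    using X(1) Y(1) by (simp_all add: flow_space_def)
  \<comment> \<open>Dropping \<open>k\<close> and \<open>l\<close> symbols respectively leaves the
    common tail.\<close>
  moreover from this have "admissible_expansion n m f \<phi> (\<lambda>j. t (l + j))"
    "admissible_expansion n m f \<psi> (\<lambda>j. t (l + j))"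
    using admissible_expansion_drop[OF _ maps s, of k] admissible_expansion_drop[OF _ maps t, of l]
    by (simp_all add: kl)
  ultimately show "flow_equivalent \<phi> \<psi>"
    using same_symbols_imp_flow_equivalent[OF _ maps] endos by blast
qed

end
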